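(* Let $p$ be a prime and let $L/K$ be a Galois extension such that $\mathrm{Gal}(L/K)$ is a finite $p$-group of rank $n$. Let $K_\phi$ be the intermediate field of $L/K$ corresponding to the Frattini subgroup of $\mathrm{Gal}(L/K)$. Then: (1) The number of intermediate fields of $L/K$ that are contained in $K_\phi$ is $S_{n,p}$. (2) For each integer $k$ with $0\le k\le n$, the number of intermediate fields of $L/K$ that are contained in $K_\phi$ and have compositum number $n-k$ is $\binom{n}{k}_p$. (3) For each integer $k$ with $0\le k\le n$, the number of intermediate fields $E$ of $L/K$ that are contained in $K_\phi$ and such that $\mathrm{Gal}(K_\phi/E)$ has rank $k$ is $\binom{n}{k}_p$.
   Context: For a prime power $q$ and integers $0\le k\le n$, the Gaussian binomial coefficient is $\binom{n}{k}_q=\frac{(q^n-1)(q^n-q)\cdots(q^n-q^{k-1})}{(q^k-1)(q^k-q)\cdots(q^k-q^{k-1})}$ if $1\le k\le n$, and $\binom{n}{0}_q=1$. Put $S_{n,q}=\sum_{k=0}^n\binom{n}{k}_q$. A finite $p$-group is a group whose order is a power of the prime $p$. The rank of a group is the smallest nonnegative integer $n$ such that the group can be generated by $n$ elements. The Frattini subgroup $\Phi(G)$ of a finite group $G$ is the intersection of all its maximal (proper) subgroups (equal to $G$ if there are none). An intermediate field of $L/K$ is a field $E$ with $K\subseteq E\subseteq L$. With $G=\mathrm{Gal}(L/K)$, the field $K_\phi$ is the fixed field of $\Phi(G)$ in $L$. A minimal intermediate field is an intermediate field $M$ such that $M/K$ has degree $p$. If $F$ is an intermediate field that is a compositum of minimal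 intermediate fields, the compositum number of $F$ is the smallest number of minimal intermediate fields whose compositum is $F$; the compositum number of $K$ is $0$ (empty compositum). *)

theory Defs
  imports "HOL-Algebra.Algebra"
begin

section \<open>Gaussian binomial coefficients\<close>

text \<open>Rational-valued, so that the quotient is a genuine quotient; the empty products
  give the value 1 for \<open>k = 0\<close>. The function is only meant for \<open>k \<le> n\<close>.\<close>

definition gauss_binomial :: "nat \<Rightarrow> nat \<Rightarrow> nat \<Rightarrow> rat" where
  "gauss_binomial q n k =
     (\<Prod>i<k. of_nat q ^ n - of_nat q ^ i) / (\<Prod>i<k. of_nat q ^ k - of_nat q ^ i)"

definition gauss_sum :: "nat \<Rightarrow> nat \<Rightarrow> rat" where
  "gauss_sum n q = (\<Sum>k=0..n. gauss_binomial q n k)"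


section \<open>Groups\<close>

definition finite_p_group :: "nat \<Rightarrow> ('a, 'b) monoid_scheme \<Rightarrow> bool" where
  "finite_p_group p G \<longleftrightarrow> group G \<and> finite (carrier G) \<and> (\<exists>m. order G = p ^ m)"

definition group_rank :: "('a, 'b) monoid_scheme \<Rightarrow> nat" where
  "group_rank G =
     (LEAST n. \<exists>S\<subseteq>carrier G. finite S \<and> card S = n \<and> generate G S = carrier G)"

definition maximal_subgroup :: "'a set \<Rightarrow> ('a, 'b) monoid_scheme \<Rightarrow> bool" where
  "maximal_subgroup M G \<longleftrightarrow> subgroup M G \<and> M \<noteq> carrier G \<and>
     (\<forall>H. subgroup H G \<longrightarrow> M \<subseteq> H \<longrightarrow> H = M \<or> H = carrier G)"

text \<open>Intersecting with the carrier yields the whole group when there are no maximal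
  subgroups.\<close>

definition frattini :: "('a, 'b) monoid_scheme \<Rightarrow> 'a set" where
  "frattini G = carrier G \<inter> \<Inter> {M. maximal_subgroup M G}"


section \<open>Galois extensions\<close>

text \<open>A field extension \<open>L/K\<close> is a ring \<open>L\<close> that is a field, with a subfield \<open>K\<close> of it. For an
  intermediate field \<open>F\<close>, the field \<open>F\<close> itself is the ring \<open>L\<lparr>carrier := F\<rparr>\<close>.

  As in \<^const>\<open>AutoGroup\<close>, automorphisms are extensional functions on the carrier, so that
  each field automorphism is represented by exactly one function.\<close>

definition galois_group :: "('a, 'b) ring_scheme \<Rightarrow> 'a set \<Rightarrow> ('a \<Rightarrow> 'a) monoid" where
  "galois_group L K =
     BijGroup (carrier L)
       \<lparr>carrier := {\<sigma> \<in> ring_hom L L \<inter> Bij (carrier L). \<forall>x\<in>K. \<sigma> x = x}\<rparr>"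

definition fixed_field :: "('a, 'b) ring_scheme \<Rightarrow> ('a \<Rightarrow> 'a) set \<Rightarrow> 'a set" where
  "fixed_field L H = {x \<in> carrier L. \<forall>\<sigma>\<in>H. \<sigma> x = x}"

text \<open>\<open>L/K\<close> is Galois: it is algebraic, and the elements of \<open>L\<close> fixed by all \<open>K\<close>-automorphisms
  are exactly those of \<open>K\<close>. The extension is not required to be finite.\<close>

definition galois_extension :: "('a, 'b) ring_scheme \<Rightarrow> 'a set \<Rightarrow> bool" where
  "galois_extension L K \<longleftrightarrow> field L \<and> subfield K L \<and>
     (\<forall>x\<in>carrier L. (ring.algebraic L over K) x) \<and>
     fixed_field L (carrier (galois_group L K)) = K"

definition intermediate_field :: "('a, 'b) ring_scheme \<Rightarrow> 'a set \<Rightarrow> 'a set \<Rightarrow> bool" where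
  "intermediate_field L K E \<longleftrightarrow> subfield E L \<and> K \<subseteq> E"

definition frattini_field :: "('a, 'b) ring_scheme \<Rightarrow> 'a set \<Rightarrow> 'a set" where
  "frattini_field L K = fixed_field L (frattini (galois_group L K))"


section \<open>Compositum number\<close>

definition minimal_intermediate_field ::
  "nat \<Rightarrow> ('a, 'b) ring_scheme \<Rightarrow> 'a set \<Rightarrow> 'a set \<Rightarrow> bool" where
  "minimal_intermediate_field p L K M \<longleftrightarrow>
     intermediate_field L K M \<and> ring.dimension L p K M"

text \<open>Adjoining \<open>K\<close> only matters for the empty family, whose compositum is \<open>K\<close>.\<close>

definition compositum :: "('a, 'b) ring_scheme \<Rightarrow> 'a set \<Rightarrow> 'a set set \<Rightarrow> 'a set" where
  "compositum L K S = generate_field L (K \<union> \<Union>S)"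

definition compositum_of_minimal ::
  "nat \<Rightarrow> ('a, 'b) ring_scheme \<Rightarrow> 'a set \<Rightarrow> nat \<Rightarrow> 'a set \<Rightarrow> bool" where
  "compositum_of_minimal p L K m F \<longleftrightarrow>
     (\<exists>S. S \<subseteq> {M. minimal_intermediate_field p L K M} \<and> finite S \<and> card S = m \<and>
          compositum L K S = F)"

text \<open>A relation rather than a function, since the compositum number is defined only for
  those \<open>F\<close> that are a compositum of minimal intermediate fields.\<close>

definition has_compositum_number ::
  "nat \<Rightarrow> ('a, 'b) ring_scheme \<Rightarrow> 'a set \<Rightarrow> 'a set \<Rightarrow> nat \<Rightarrow> bool" where
  "has_compositum_number p L K F m \<longleftrightarrow>
     compositum_of_minimal p L K m F \<and> (\<forall>j<m. \<not> compositum_of_minimal p L K j F)"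

end

theory Submission
  imports Defs
begin

text \<open>Write \<open>G\<close> for the Galois group and \<open>V\<close> for the Galois group of \<open>K_\<phi>/K\<close>, which is the quotient
  of \<open>G\<close> by its Frattini subgroup. Maximal subgroups of a finite \<open>p\<close>-group are normal of index \<open>p\<close>,
  so \<open>V\<close> is elementary abelian; since a subset of \<open>G\<close> generates \<open>G\<close> iff its image generates \<open>V\<close>, the
  order of \<open>V\<close> is \<open>p ^ n\<close>. The Galois correspondence for \<open>K_\<phi>/K\<close> turns the three counts into
  counts of subspaces of an \<open>n\<close>-dimensional space over the field with \<open>p\<close> elements: a subspace
  of order \<open>p ^ k\<close> has rank \<open>k\<close> and is the intersection of \<open>n - k\<close> hyperplanes but of no fewer, and
  the minimal intermediate fields correspond to the hyperplanes.\<close>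

section \<open>Maximal subgroups of finite p-groups\<close>

text \<open>What is given is a finite group of automorphisms, not a degree. The correspondence is
  therefore derived for a finite group \<open>H\<close> of automorphisms of a field relative to the
  fixed field of \<open>H\<close>. Dedekind's independence of automorphisms does two things: it
  makes the trace onto the fixed field surjective, and it shows that every automorphism fixing that
  field belongs to \<open>H\<close>. That a field E between is the fixed field of its stabilizer
  comes from interpolation with elements of E instead of a comparison of degrees. The same
  interpolation with powers of a single element yields the only degree formula that is needed, the
  one behind the degree \<open>p\<close> of the fixed fields of hyperplanes. No automorphism is ever
  extended from K_\<phi> to L: the restrictions form a finite group with fixed field K, so they
  already exhaust the Galois group of K_\<phi>/K. On the group side all linear algebra is arithmetic
  of subgroup orders, and the two products in the Gaussian binomial arise as numbers of ordered
  independent tuples.\<close>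

lemma (in group) conj_closed_imp_in_normalizer:
  assumes "subgroup H G" and "x \<in> carrier G" and "finite H"
    and conj: "\<And>h. h \<in> H \<Longrightarrow> x \<otimes> h \<otimes> inv x \<in> H"
  shows "x \<in> normalizer G H"
proof -
  have H: "H \<subseteq> carrier G" using assms(1) by (rule subgroup.subset)
  have "x <# H #> inv x = (\<lambda>h. x \<otimes> h \<otimes> inv x) ` H"
    unfolding l_coset_def r_coset_def by auto
  moreover have "(\<lambda>h. x \<otimes> h \<otimes> inv x) ` H = H"
  \<comment> \<open>An injection of a finite set into itself is onto, so the one-sided hypothesis
    \<open>conj\<close> gives the equality that the normalizer demands.\<close>
  proof (rule endo_inj_surj)
    show "inj_on (\<lambda>h. x \<otimes> h \<otimes> inv x) H"
      using H assms(2) by (auto intro!: inj_onI)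
        (metis conjugation_is_inj subsetD)
  qed (use assms in auto)
  ultimately show ?thesis
    unfolding normalizer_def stabilizer_def using H assms(2) by auto
qed

text \<open>Normality makes the product of \<open>H\<close> with the powers of \<open>x\<close> a
  subgroup, and \<open>H\<close> absorbs \<open>x [^] p\<close>, so exponents matter only mod
  \<open>p\<close>. This bounds the index of \<open>H\<close> by \<open>p\<close>.\<close>

lemma (in group) generate_insert_normal_subset:
  fixes p :: nat
  assumes "H \<lhd> G" and x: "x \<in> carrier G" and xp: "x [^] p \<in> H" and "p > 0"
  shows "generate G (insert x H) \<subseteq> (\<lambda>(h, i). h \<otimes> x [^] i) ` (H \<times> {..<p})"
proof
  interpret N: second_isomorphism_grp H G "generate G {x}"
    unfolding second_isomorphism_grp_def second_isomorphism_grp_axioms_def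
    using assms generate_is_subgroup[of "{x}"] by auto
  have "x \<in> generate G {x}" by (simp add: generate.incl)
  hence "insert x H \<subseteq> H <#> generate G {x}"
    using N.H_contained_in_set_mult N.S_contained_in_set_mult by auto
  hence sub: "generate G (insert x H) \<subseteq> H <#> generate G {x}"
    by (rule generate_subgroup_incl[OF _ N.normal_set_mult_subgroup])
  fix y assume "y \<in> generate G (insert x H)"
  then obtain h k where h: "h \<in> H" and y: "y = h \<otimes> x [^] (k :: int)"
    using sub generate_pow[OF x] unfolding set_mult_def by auto
  define i where "i = nat (k mod int p)"
  have i: "i < p" "int i = k mod int p"
    unfolding i_def using \<open>p > 0\<close> by (auto simp: nat_less_iff)
  have "k = int p * (k div int p) + int i"
    using i by simp
  hence "x [^] k = (x [^] int p) [^] (k div int p) \<otimes> x [^] int i"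
    using x by (metis int_pow_mult int_pow_pow)
  moreover have "(x [^] int p) [^] (k div int p) \<in> H"
    using xp subgroup_int_pow_closed[OF N.is_subgroup] by (simp add: int_pow_int)
  ultimately obtain h' where "h' \<in> H" "x [^] k = h' \<otimes> x [^] i"
    by (auto simp: int_pow_int)
  with h y x have "y = (h \<otimes> h') \<otimes> x [^] i" "h \<otimes> h' \<in> H"
    by (auto simp: m_assoc N.mem_carrier)
  with i show "y \<in> (\<lambda>(h, i). h \<otimes> x [^] i) ` (H \<times> {..<p})"
    by auto
qed

lemma card_subgroup_p_group:
  assumes "Factorial_Ring.prime p" "finite_p_group p G" "subgroup H G"
  obtains a where "card H = p ^ a"
proof -
  interpret group G using assms(2) by (simp add: finite_p_group_def)
  obtain m where "order G = p ^ m" using assms(2) by (auto simp: finite_p_group_def)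
  moreover have "card H dvd order G"
    using lagrange[OF assms(3)] by (metis dvd_triv_right)
  ultimately show ?thesis using that divides_primepow_nat[OF assms(1)] by auto
qed

lemma card_subgroup_less_p_group:
  assumes p: "Factorial_Ring.prime p" and G: "finite_p_group p G"
    and H: "subgroup H G" and K: "subgroup K G" and less: "H \<subset> K"
  shows "p * card H \<le> card K" and "p * card H dvd card K"
proof -
  interpret group G using assms(2) by (simp add: finite_p_group_def)
  obtain a where a: "card H = p ^ a" by (rule card_subgroup_p_group[OF p G H])
  obtain b where b: "card K = p ^ b" by (rule card_subgroup_p_group[OF p G K])
  have "finite K"
    using G K by (meson finite_p_group_def finite_subset subgroup.subset)
  hence "card H < card K" using less by (rule psubset_card_mono)
  hence "Suc a \<le> b" using a b power_less_imp_less_exp[OF prime_gt_1_nat[OF p], of a b] by simp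
  hence "p ^ Suc a dvd p ^ b" by (rule le_imp_power_dvd)
  thus "p * card H dvd card K" using a b by simp
  thus "p * card H \<le> card K"
    using b prime_gt_0_nat[OF p] by (simp add: dvd_imp_le)
qed

text \<open>At most \<open>p\<close> cosets by the preceding normal form; at least a factor
  \<open>p\<close> because the orders of properly nested subgroups of a \<open>p\<close>-group
  differ by one. This is the step by one dimension in all later counts.\<close>

lemma card_generate_insert:
  fixes G (structure)
  assumes p: "Factorial_Ring.prime p" and G: "finite_p_group p G"
    and H: "H \<lhd> G" and x: "x \<in> carrier G" "x \<notin> H" and xp: "x [^]\<^bsub>G\<^esub> p \<in> H"
  shows "card (generate G (insert x H)) = p * card H"
proof (rule antisym)
  interpret group G using G by (simp add: finite_p_group_def)
  have sub: "H \<subseteq> carrier G" using H by (meson normal_imp_subgroup subgroup.subset)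
  have fin: "finite H" using G sub finite_subset by (auto simp: finite_p_group_def)
  have "card (generate G (insert x H)) \<le> card ((\<lambda>(h, i). h \<otimes> x [^] i) ` (H \<times> {..<p}))"
    using generate_insert_normal_subset[OF H x(1) xp prime_gt_0_nat[OF p]] fin
    by (intro card_mono) auto
  also have "\<dots> \<le> card (H \<times> {..<p})" using fin by (intro card_image_le) auto
  finally show "card (generate G (insert x H)) \<le> p * card H"
    by (simp add: card_cartesian_product mult.commute)
  have "H \<subseteq> generate G (insert x H)" "x \<in> generate G (insert x H)"
    by (auto intro: generate.incl)
  hence "H \<subset> generate G (insert x H)" using x by auto
  thus "p * card H \<le> card (generate G (insert x H))"
    using card_subgroup_less_p_group(1)[OF p G normal_imp_subgroup[OF H] generate_is_subgroup] sub x
    by auto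
qed

section \<open>Coset actions and normality of maximal subgroups\<close>

text \<open>Orbit sizes are powers of \<open>p\<close>, so modulo \<open>p\<close> only the
  singleton orbits survive in the sum over all orbits.\<close>

lemma (in group_action) p_group_fixed_points:
  assumes p: "Factorial_Ring.prime p" and ord: "order G = p ^ m" and fin: "finite E"
  shows "card {x \<in> E. \<forall>g \<in> carrier G. \<phi> g x = x} mod p = card E mod p"
proof -
  let ?F = "{x \<in> E. \<forall>g \<in> carrier G. \<phi> g x = x}"
  have part: "(\<Sum>orb\<in>orbits G E \<phi>. card orb) = card E"
    using disjoint_sum[OF fin, of "\<lambda>_. 1::nat"] by simp
  have finO: "finite (orbits G E \<phi>)"
    using fin unfolding orbits_def by simp
  have card_orb: "card (orbit G \<phi> x) dvd p ^ m" if "x \<in> E" for x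
    using orbit_stabilizer_theorem[OF that] ord by (metis dvd_triv_left)
  have self: "x \<in> orbit G \<phi> x" if "x \<in> E" for x
    using orbit_refl[OF that] .
  have "(\<Sum>orb\<in>orbits G E \<phi>. card orb) mod p
      = (\<Sum>orb\<in>orbits G E \<phi>. card orb mod p) mod p"
    by (simp add: mod_sum_eq)
  also have "(\<Sum>orb\<in>orbits G E \<phi>. card orb mod p)
      = (\<Sum>orb\<in>orbits G E \<phi>. if card orb = 1 then 1 else 0)"
  proof (rule sum.cong[OF refl])
    fix orb assume "orb \<in> orbits G E \<phi>"
    then obtain x where "x \<in> E" "orb = orbit G \<phi> x" unfolding orbits_def by auto
    then obtain i where i: "card orb = p ^ i"
      using card_orb divides_primepow_nat[OF p] by blast
    show "card orb mod p = (if card orb = 1 then 1 else 0)"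
      using i prime_gt_1_nat[OF p] by (cases i) auto
  qed
  also have "\<dots> = card {orb \<in> orbits G E \<phi>. card orb = 1}"
    using finO by (simp add: sum.If_cases Int_def)
  also have "{orb \<in> orbits G E \<phi>. card orb = 1} = (\<lambda>x. {x}) ` ?F"
  proof (intro equalityI subsetI)
    fix orb assume "orb \<in> {orb \<in> orbits G E \<phi>. card orb = 1}"
    then obtain x y where x: "x \<in> E" "orb = orbit G \<phi> x" "orb = {y}"
      unfolding orbits_def by (auto simp: card_1_singleton_iff)
    hence "orb = {x}" using self[OF x(1)] by (metis singletonD)
    moreover have "\<phi> g x = x" if "g \<in> carrier G" for g
      using x \<open>orb = {x}\<close> that unfolding orbit_def by blast
    ultimately show "orb \<in> (\<lambda>x. {x}) ` ?F" using x by auto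
  next
    fix orb assume "orb \<in> (\<lambda>x. {x}) ` ?F"
    then obtain x where x: "x \<in> E" "\<forall>g \<in> carrier G. \<phi> g x = x" "orb = {x}" by auto
    hence "orbit G \<phi> x = {x}" using self[OF x(1)] unfolding orbit_def by auto
    thus "orb \<in> {orb \<in> orbits G E \<phi>. card orb = 1}"
      using x unfolding orbits_def by (auto intro!: exI[of _ x])
  qed
  also have "card \<dots> = card ?F" by (rule card_image) auto
  finally show ?thesis using part by simp
qed

text \<open>The inverse turns multiplication from the right into a homomorphism; the restriction to
  the set of cosets supplies the extensionality that \<open>BijGroup\<close> demands.\<close>

lemma (in group) right_coset_action:
  assumes H: "subgroup H G"
  shows "group_action G (rcosets H) (\<lambda>g. \<lambda>R \<in> rcosets H. R #> inv g)"
proof -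
  have HG: "H \<subseteq> carrier G" using H by (rule subgroup.subset)
  have sub: "R \<subseteq> carrier G" if "R \<in> rcosets H" for R
    using that subgroup.rcosets_carrier[OF H group_axioms] by auto
  have act: "R #> g \<in> rcosets H" if R: "R \<in> rcosets H" and g: "g \<in> carrier G" for R g
  proof -
    obtain a where "a \<in> carrier G" "R = H #> a" using R unfolding RCOSETS_def by auto
    thus ?thesis using coset_mult_assoc[OF HG] g rcosetsI[OF HG] by auto
  qed
  have Bij: "(\<lambda>R \<in> rcosets H. R #> inv g) \<in> Bij (rcosets H)" if g: "g \<in> carrier G" for g
  proof -
    have "bij_betw (\<lambda>R. R #> inv g) (rcosets H) (rcosets H)"
      by (rule bij_betw_byWitness[of _ "\<lambda>R. R #> g"])
        (use g act in \<open>auto simp: coset_mult_assoc[OF sub] coset_mult_one[OF sub]\<close>)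
    thus ?thesis unfolding Bij_def
      by (simp add: bij_betw_cong[of "rcosets H" "\<lambda>R \<in> rcosets H. R #> inv g" "\<lambda>R. R #> inv g"])
  qed
  show ?thesis
    unfolding group_action_def group_hom_def group_hom_axioms_def
  proof (intro conjI group_BijGroup homI)
    show "group G" by (rule group_axioms)
    fix g assume "g \<in> carrier G"
    thus "(\<lambda>R \<in> rcosets H. R #> inv g) \<in> carrier (BijGroup (rcosets H))"
      using Bij by (simp add: BijGroup_def)
  next
    fix g h assume gh: "g \<in> carrier G" "h \<in> carrier G"
    show "(\<lambda>R \<in> rcosets H. R #> inv (g \<otimes> h)) =
      (\<lambda>R \<in> rcosets H. R #> inv g) \<otimes>\<^bsub>BijGroup (rcosets H)\<^esub> (\<lambda>R \<in> rcosets H. R #> inv h)"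
    proof
      fix R
      have "R #> (inv h \<otimes> inv g) = R #> inv h #> inv g" if "R \<in> rcosets H"
        using coset_mult_assoc[OF sub[OF that], of "inv h" "inv g"] gh by simp
      thus "(\<lambda>R \<in> rcosets H. R #> inv (g \<otimes> h)) R =
        ((\<lambda>R \<in> rcosets H. R #> inv g) \<otimes>\<^bsub>BijGroup (rcosets H)\<^esub> (\<lambda>R \<in> rcosets H. R #> inv h)) R"
        using Bij[OF gh(1)] Bij[OF gh(2)] act[of R "inv h"] gh
        by (simp add: BijGroup_def compose_def inv_mult_group)
    qed
  qed
qed

text \<open>Let \<open>M\<close> act on its own cosets. Their number is divisible by
  \<open>p\<close> and the coset \<open>M\<close> is fixed, so a second coset \<open>M #> y\<close>
  is fixed too. Then \<open>y\<close> normalizes \<open>M\<close> without lying in it, and by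
  maximality the normalizer is the whole group.\<close>

lemma p_group_maximal_subgroup_normal:
  fixes G (structure)
  assumes p: "Factorial_Ring.prime p" and G: "finite_p_group p G" and M: "maximal_subgroup M G"
  shows "M \<lhd> G"
proof -
  interpret group G using G by (simp add: finite_p_group_def)
  have fin: "finite (carrier G)" using G by (simp add: finite_p_group_def)
  have sM: "subgroup M G" and neq: "M \<noteq> carrier G"
    and max: "\<And>H. subgroup H G \<Longrightarrow> M \<subseteq> H \<Longrightarrow> H = M \<or> H = carrier G"
    using M by (auto simp: maximal_subgroup_def)
  have MG: "M \<subseteq> carrier G" by (rule subgroup.subset[OF sM])
  have finM: "finite M" using fin MG by (rule rev_finite_subset)
  let ?\<phi> = "\<lambda>g. \<lambda>R \<in> rcosets M. R #> inv g"
  interpret A: group_action "G\<lparr>carrier := M\<rparr>" "rcosets M" ?\<phi>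
    by (rule group_action.induced_action[OF right_coset_action[OF sM] sM])
  obtain a where a: "card M = p ^ a" by (rule card_subgroup_p_group[OF p G sM])
  let ?F = "{R \<in> rcosets M. \<forall>g \<in> carrier (G\<lparr>carrier := M\<rparr>). ?\<phi> g R = R}"
  have "p * card M dvd card (rcosets M) * card M"
    using card_subgroup_less_p_group(2)[OF p G sM subgroup_self] MG neq lagrange[OF sM]
    by (auto simp: order_def)
  hence "p dvd card (rcosets M)"
    using a prime_gt_0_nat[OF p] by simp
  moreover have "finite (rcosets M)" using fin by (simp add: RCOSETS_def)
  moreover have "order (G\<lparr>carrier := M\<rparr>) = p ^ a" using a by (simp add: order_def)
  ultimately have "p dvd card ?F"
    using A.p_group_fixed_points[OF p] by (metis (lifting) dvd_eq_mod_eq_0)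
  moreover have MF: "M \<in> ?F"
    using subgroup.subgroup_in_rcosets[OF sM group_axioms] coset_join2 sM
    by (auto simp: subgroup.m_inv_closed subgroup.mem_carrier)
  moreover have "finite ?F" using \<open>finite (rcosets M)\<close> by simp
  ultimately have "?F \<noteq> {M}"
  proof -
    assume dvd: "p dvd card ?F"
    show ?thesis
    proof
      assume "?F = {M}"
      hence "card ?F = 1" by simp
      thus False using dvd prime_gt_1_nat[OF p] by simp
    qed
  qed
  then obtain R where R: "R \<in> ?F" "R \<noteq> M" using MF by blast
  then obtain y where y: "y \<in> carrier G" "R = M #> y" by (auto simp: RCOSETS_def)
  have "y \<notin> M" using R y coset_join2[OF _ sM] by auto
  have conj: "y \<otimes> h \<otimes> inv y \<in> M" if h: "h \<in> M" for h
  proof -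
    have hG: "h \<in> carrier G" using h MG by auto
    \<comment> \<open>The action multiplies by the inverse, so it is applied to \<open>inv h\<close>
      to obtain multiplication by \<open>h\<close>.\<close>
    have "?\<phi> (inv h) R = R" using R h subgroup.m_inv_closed[OF sM] by auto
    hence "M #> y #> h = M #> y" using R y hG by auto
    hence "M #> (y \<otimes> h) = M #> y" using MG y hG by (simp add: coset_mult_assoc)
    moreover have "y \<otimes> h \<in> M #> (y \<otimes> h)"
      using rcos_self[OF _ sM, of "y \<otimes> h"] y hG by auto
    ultimately show ?thesis
      using subgroup.rcos_module_imp[OF sM group_axioms y(1)] by auto
  qed
  have ynorm: "y \<in> normalizer G M"
    using conj_closed_imp_in_normalizer[OF sM y(1) finM conj] by auto
  have Mnorm: "M \<subseteq> normalizer G M"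
  proof
    fix m assume "m \<in> M"
    thus "m \<in> normalizer G M"
      using conj_closed_imp_in_normalizer[OF sM _ finM, of m] MG subgroup.m_closed[OF sM]
        subgroup.m_inv_closed[OF sM] by auto
  qed
  have "normalizer G M = carrier G"
    using max[OF normalizer_imp_subgroup[OF MG] Mnorm] ynorm \<open>y \<notin> M\<close> by auto
  show ?thesis
  proof (unfold normal_inv_iff, intro conjI ballI sM)
    fix x h assume x: "x \<in> carrier G" and h: "h \<in> M"
    have "x <# M #> inv x = M"
      using x \<open>normalizer G M = carrier G\<close> MG unfolding normalizer_def stabilizer_def by auto
    moreover have "x \<otimes> h \<otimes> inv x \<in> x <# M #> inv x"
      using h unfolding l_coset_def r_coset_def by auto
    ultimately show "x \<otimes> h \<otimes> inv x \<in> M" by simp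
  qed
qed

text \<open>Both facts are read off the quotient by \<open>M\<close>, once its order is known to be
  \<open>p\<close>: powers by Lagrange, commutators because the quotient is cyclic.\<close>

lemma
  fixes G (structure)
  assumes p: "Factorial_Ring.prime p" and G: "finite_p_group p G" and M: "maximal_subgroup M G"
  shows p_group_maximal_subgroup_pow: "x \<in> carrier G \<Longrightarrow> x [^]\<^bsub>G\<^esub> p \<in> M"
    and p_group_maximal_subgroup_derived: "derived_set G (carrier G) \<subseteq> M"
proof -
  interpret group G using G by (simp add: finite_p_group_def)
  have fin: "finite (carrier G)" using G by (simp add: finite_p_group_def)
  have sM: "subgroup M G" and neq: "M \<noteq> carrier G"
    and max: "\<And>H. subgroup H G \<Longrightarrow> M \<subseteq> H \<Longrightarrow> H = M \<or> H = carrier G"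
    using M by (auto simp: maximal_subgroup_def)
  have MG: "M \<subseteq> carrier G" by (rule subgroup.subset[OF sM])
  interpret N: normal M G by (rule p_group_maximal_subgroup_normal[OF assms])
  obtain x where x: "x \<in> carrier G" "x \<notin> M" using neq MG by auto
  obtain m where m: "order G = p ^ m" using G by (auto simp: finite_p_group_def)
  \<comment> \<open>One step before the first power that falls into \<open>M\<close> there is a
    \<open>y\<close> outside \<open>M\<close> with \<open>y [^] p\<close> inside. Adjoining it to
    \<open>M\<close> multiplies the order by exactly \<open>p\<close>, and maximality makes the
    result the whole group.\<close>
  let ?i = "LEAST i. x [^] (p ^ i) \<in> M"
  have "x [^] (p ^ m) \<in> M"
    using pow_order_eq_1[OF x(1)] m subgroup.one_closed[OF sM] by simp
  hence i: "x [^] (p ^ ?i) \<in> M" by (rule LeastI)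
  have "?i \<noteq> 0" using i x by (metis nat_pow_eone power_0)
  then obtain j where j: "?i = Suc j" by (cases ?i) auto
  define y where "y = x [^] (p ^ j)"
  have y: "y \<in> carrier G" "y \<notin> M"
    using x not_less_Least[of j "\<lambda>i. x [^] (p ^ i) \<in> M"] j by (auto simp: y_def)
  have "y [^] p \<in> M" using i j x by (simp add: y_def nat_pow_pow mult.commute)
  hence card: "card (generate G (insert y M)) = p * card M"
    using card_generate_insert[OF p G N.normal_axioms y] by simp
  have "subgroup (generate G (insert y M)) G" "M \<subseteq> generate G (insert y M)"
    "y \<in> generate G (insert y M)"
    using y MG by (auto intro!: generate_is_subgroup generate.incl)
  hence gen: "generate G (insert y M) = carrier G" using max y by blast
  have ord: "order G = p * card M" using card gen by (simp add: order_def)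
  have Q: "group (G Mod M)" by (rule N.factorgroup_is_group)
  have ordQ: "order (G Mod M) = p"
    using lagrange[OF sM] ord subgroup.finite_imp_card_positive[OF sM fin]
    by (simp add: order_def FactGroup_def)
  have hom: "(\<lambda>a. M #> a) \<in> hom G (G Mod M)" by (rule N.r_coset_hom_Mod)
  interpret q: group_hom G "G Mod M" "\<lambda>a. M #> a"
    unfolding group_hom_def group_hom_axioms_def using Q hom group_axioms by simp
  show "x [^] p \<in> M" if x: "x \<in> carrier G" for x
  proof -
    have "M #> (x [^] p) = \<one>\<^bsub>G Mod M\<^esub>"
      using q.hom_nat_pow[OF x, of p] group.pow_order_eq_1[OF Q, of "M #> x"] q.hom_closed[OF x]
        ordQ by simp
    thus ?thesis using coset_join1[OF _ _ sM] x MG by simp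
  qed
  have cover: "carrier G \<subseteq> (\<lambda>(h, i). h \<otimes> y [^] i) ` (M \<times> {..<p})"
    using generate_insert_normal_subset[OF N.normal_axioms y(1) \<open>y [^] p \<in> M\<close> prime_gt_0_nat[OF p]] gen
    by simp
  \<comment> \<open>By \<open>cover\<close> every coset is a power of \<open>M #> y\<close>, and
    powers of one element commute.\<close>
  have "comm_group (G Mod M)"
  proof (rule group.group_comm_groupI[OF Q])
    fix a b assume "a \<in> carrier (G Mod M)" "b \<in> carrier (G Mod M)"
    moreover have "\<exists>i. a = (M #> y) [^]\<^bsub>G Mod M\<^esub> (i :: nat)" if "a \<in> carrier (G Mod M)" for a
    proof -
      obtain x where x: "x \<in> carrier G" "a = M #> x"
        using \<open>a \<in> carrier (G Mod M)\<close> by (auto simp: FactGroup_def RCOSETS_def)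
      then obtain h and i :: nat where h: "h \<in> M" "x = h \<otimes> y [^] i" using subsetD[OF cover x(1)] by auto
      have "a = (M #> h) \<otimes>\<^bsub>G Mod M\<^esub> (M #> y) [^]\<^bsub>G Mod M\<^esub> i"
        using x h y MG q.hom_mult[of h "y [^] i"] q.hom_nat_pow[OF y(1), of i] by auto
      also have "M #> h = \<one>\<^bsub>G Mod M\<^esub>" using h coset_join2[OF _ sM] MG by auto
      also have "\<one>\<^bsub>G Mod M\<^esub> \<otimes>\<^bsub>G Mod M\<^esub> (M #> y) [^]\<^bsub>G Mod M\<^esub> i = (M #> y) [^]\<^bsub>G Mod M\<^esub> i"
        using q.hom_closed[OF y(1)] by (simp add: q.H.l_one del: one_FactGroup mult_FactGroup)
      finally show ?thesis by blast
    qed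
    ultimately obtain i j where
      "a = (M #> y) [^]\<^bsub>G Mod M\<^esub> (i :: nat)" "b = (M #> y) [^]\<^bsub>G Mod M\<^esub> (j :: nat)" by meson
    thus "a \<otimes>\<^bsub>G Mod M\<^esub> b = b \<otimes>\<^bsub>G Mod M\<^esub> a"
      using q.hom_closed[OF y(1)] q.H.nat_pow_mult by (metis add.commute)
  qed
  hence "derived G (carrier G) \<subseteq> M" by (rule derived_minimal[OF N.normal_axioms])
  moreover have "derived_set G (carrier G) \<subseteq> derived G (carrier G)"
    unfolding derived_def by (meson generate.incl subsetI)
  ultimately show "derived_set G (carrier G) \<subseteq> M" by (rule subset_trans[rotated])
qed

section \<open>Elementary abelian groups\<close>

lemma (in group) generate_insert_generate:
  assumes "S \<subseteq> carrier G" "x \<in> carrier G"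
  shows "generate G (insert x (generate G S)) = generate G (insert x S)"
proof
  have sub: "insert x (generate G S) \<subseteq> generate G (insert x S)"
    using mono_generate[of S "insert x S"] by (auto intro: generate.incl)
  show "generate G (insert x (generate G S)) \<subseteq> generate G (insert x S)"
    by (rule generate_subgroup_incl[OF sub generate_is_subgroup]) (use assms in auto)
  show "generate G (insert x S) \<subseteq> generate G (insert x (generate G S))"
    by (rule mono_generate) (auto intro: generate.incl)
qed

text \<open>This stands for a finite vector space over the field with \<open>p\<close> elements
  without introducing scalars: subspaces are subgroups, and dimension is the exponent of the
  order.\<close>

locale elementary_abelian_group = comm_group G for G (structure) +
  fixes p :: nat
  assumes prime: "Factorial_Ring.prime p"
    and p_group: "finite_p_group p G"
    and exponent: "x \<in> carrier G \<Longrightarrow> x [^] p = \<one>"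
begin

abbreviation hyperplane :: "'a set \<Rightarrow> bool" where
  "hyperplane M \<equiv> subgroup M G \<and> order G = p * card M"

lemma finite_carrier: "finite (carrier G)"
  using p_group by (simp add: finite_p_group_def)

lemma p_gt_1: "p > 1" by (rule prime_gt_1_nat[OF prime])

lemma finite_subgroup: "subgroup W G \<Longrightarrow> finite W"
  using finite_carrier subgroup.subset finite_subset by blast

lemma finite_subgroups: "finite {W. subgroup W G}"
  by (rule finite_subset[of _ "Pow (carrier G)"]) (auto simp: finite_carrier dest: subgroup.subset)

lemma card_insert_subgroup:
  assumes "subgroup W G" "x \<in> carrier G" "x \<notin> W"
  shows "card (generate G (insert x W)) = p * card W"
  using card_generate_insert[OF prime p_group, of W x] assms exponent subgroup.one_closed[OF assms(1)]
  by (simp add: normal_iff_subgroup)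

lemma subgroup_elementary_abelian:
  assumes "subgroup W G"
  shows "elementary_abelian_group (G\<lparr>carrier := W\<rparr>) p"
proof -
  interpret W: comm_group "G\<lparr>carrier := W\<rparr>"
    using subgroup_imp_group[OF assms] subgroup.mem_carrier[OF assms] m_comm
    by (intro group.group_comm_groupI) auto
  obtain a where "card W = p ^ a" by (rule card_subgroup_p_group[OF prime p_group assms])
  hence "finite_p_group p (G\<lparr>carrier := W\<rparr>)"
    unfolding finite_p_group_def using finite_subgroup[OF assms] W.is_group
    by (auto simp: order_def)
  moreover have "x [^]\<^bsub>G\<lparr>carrier := W\<rparr>\<^esub> p = \<one>\<^bsub>G\<lparr>carrier := W\<rparr>\<^esub>" if "x \<in> W" for x
    using exponent subgroup.mem_carrier[OF assms that] by (simp add: nat_pow_consistent[symmetric])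
  ultimately show ?thesis
    using prime by unfold_locales auto
qed

section \<open>Rank and order\<close>

text \<open>A new generator either changes nothing or multiplies the order by \<open>p\<close>. This
  is the lower bound for the rank.\<close>

lemma card_generate_le:
  assumes "finite S" "S \<subseteq> carrier G"
  shows "card (generate G S) \<le> p ^ card S"
  using assms
proof (induction S)
  case empty
  show ?case by (simp add: generate_empty)
next
  case (insert x S)
  have sub: "subgroup (generate G S) G" using insert by (intro generate_is_subgroup) auto
  have eq: "generate G (insert x S) = generate G (insert x (generate G S))"
    using insert generate_insert_generate by auto
  have "card (generate G (insert x S)) \<le> p * card (generate G S)"
  proof (cases "x \<in> generate G S")
    case True
    hence "generate G (insert x S) = generate G (generate G S)" using eq by (simp add: insert_absorb)
    also have "\<dots> = generate G S" using generateI[OF sub] by auto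
    finally show ?thesis using p_gt_1 by simp
  next
    case False
    thus ?thesis using card_insert_subgroup[OF sub] insert eq by auto
  qed
  also have "\<dots> \<le> p * p ^ card S" using insert by simp
  finally show ?case using insert by simp
qed

text \<open>Greedy choice: as long as the order is below \<open>p ^ m\<close>, some element lies
  outside the subgroup generated so far. For \<open>k = m\<close> this provides a basis.\<close>

lemma exists_independent_set:
  assumes "order G = p ^ m" "k \<le> m"
  shows "\<exists>S\<subseteq>carrier G. finite S \<and> card S = k \<and> card (generate G S) = p ^ k"
  using assms(2)
proof (induction k)
  case 0
  show ?case by (intro exI[of _ "{}"]) (simp add: generate_empty)
next
  case (Suc k)
  then obtain S where S: "S \<subseteq> carrier G" "finite S" "card S = k" "card (generate G S) = p ^ k" by auto
  have sub: "subgroup (generate G S) G" using S by (intro generate_is_subgroup) auto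
  have "p ^ k < p ^ m" using Suc p_gt_1 by (simp add: power_strict_increasing)
  hence "generate G S \<noteq> carrier G" using S assms by (auto simp: order_def)
  then obtain x where x: "x \<in> carrier G" "x \<notin> generate G S" using subgroup.subset[OF sub] by auto
  hence "x \<notin> S" by (auto intro: generate.incl)
  moreover have "card (generate G (insert x S)) = p ^ Suc k"
    using card_insert_subgroup[OF sub x] generate_insert_generate[OF S(1) x(1)] S by simp
  ultimately show ?case using S x by (intro exI[of _ "insert x S"]) auto
qed

lemma group_rank_eq:
  assumes "order G = p ^ m"
  shows "group_rank G = m"
  unfolding group_rank_def
proof (rule Least_equality)
  obtain S where S: "S \<subseteq> carrier G" "finite S" "card S = m" "card (generate G S) = p ^ m"
    using exists_independent_set[OF assms order_refl] by auto
  have "generate G S = carrier G"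
    by (rule card_subset_eq[OF finite_carrier generate_incl[OF S(1)]]) (use S assms in \<open>simp add: order_def\<close>)
  thus "\<exists>S\<subseteq>carrier G. finite S \<and> card S = m \<and> generate G S = carrier G" using S by blast
next
  fix k assume "\<exists>S\<subseteq>carrier G. finite S \<and> card S = k \<and> generate G S = carrier G"
  then obtain S where "S \<subseteq> carrier G" "finite S" "card S = k" "generate G S = carrier G" by auto
  hence "p ^ m \<le> p ^ k" using card_generate_le[of S] assms by (simp add: order_def)
  thus "m \<le> k" using p_gt_1 by simp
qed

section \<open>Counting independent tuples and subgroups\<close>

text \<open>Linear independence of ordered tuples, grown at the head so that the list recursion
  matches the choice of one further vector.\<close>

primrec indep :: "'a list \<Rightarrow> bool" where
  "indep [] \<longleftrightarrow> True"
| "indep (x # xs) \<longleftrightarrow> x \<in> carrier G \<and> x \<notin> generate G (set xs) \<and> indep xs"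

lemma indep_card_generate:
  "indep xs \<Longrightarrow> set xs \<subseteq> carrier G \<and> card (generate G (set xs)) = p ^ length xs"
proof (induction xs)
  case (Cons x xs)
  have "subgroup (generate G (set xs)) G" using Cons by (intro generate_is_subgroup) auto
  thus ?case using Cons card_insert_subgroup[of "generate G (set xs)" x]
      generate_insert_generate[of "set xs" x] by simp
qed (simp add: generate_empty)

text \<open>An independent tail of length \<open>k\<close> generates \<open>p ^ k\<close> elements
  of \<open>W\<close>, and the next entry may be any of the others.\<close>

lemma card_indep_lists:
  assumes W: "subgroup W G" and card: "card W = p ^ w"
  shows "rat_of_nat (card {xs. set xs \<subseteq> W \<and> length xs = k \<and> indep xs}) =
    (\<Prod>i<k. of_nat p ^ w - of_nat p ^ i)"
proof (induction k)
  case 0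
  have "{xs. set xs \<subseteq> W \<and> length xs = 0 \<and> indep xs} = {[]}" by auto
  thus ?case by simp
next
  case (Suc k)
  let ?T = "\<lambda>k. {xs. set xs \<subseteq> W \<and> length xs = k \<and> indep xs}"
  have finT: "finite (?T k)"
    by (rule finite_subset[OF _ finite_lists_length_eq[OF finite_subgroup[OF W], of k]]) auto
  have "?T (Suc k) = (\<lambda>(xs, x). x # xs) ` (SIGMA xs:?T k. W - generate G (set xs))"
    using subgroup.mem_carrier[OF W] by (auto simp: length_Suc_conv image_iff)
  moreover have "inj_on (\<lambda>(xs, x). x # xs) (SIGMA xs:?T k. W - generate G (set xs))"
    by (auto simp: inj_on_def)
  ultimately have "card (?T (Suc k)) = card (SIGMA xs:?T k. W - generate G (set xs))"
    by (simp add: card_image)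
  also have "\<dots> = (\<Sum>xs\<in>?T k. card (W - generate G (set xs)))"
    using finT finite_subgroup[OF W] by (intro card_SigmaI) auto
  \<comment> \<open>If \<open>k\<close> exceeds \<open>w\<close> there are no tails and the sum is
    empty, so the difference never has to be read as a truncated one; for an existing tail its
    generated subgroup lies in \<open>W\<close>.\<close>
  also have "rat_of_nat \<dots> = (\<Sum>xs\<in>?T k. of_nat p ^ w - of_nat p ^ k)"
    unfolding of_nat_sum
  proof (rule sum.cong[OF refl])
    fix xs assume xs: "xs \<in> ?T k"
    have sub: "generate G (set xs) \<subseteq> W" using xs W by (intro generate_subgroup_incl) auto
    have "card (W - generate G (set xs)) = card W - card (generate G (set xs))"
      using finite_subgroup[OF W] sub finite_subset by (intro card_Diff_subset) auto
    moreover have "card (generate G (set xs)) \<le> card W"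
      using sub finite_subgroup[OF W] by (rule card_mono[rotated])
    ultimately show "rat_of_nat (card (W - generate G (set xs))) = of_nat p ^ w - of_nat p ^ k"
      using indep_card_generate[of xs] xs card by (simp add: of_nat_diff)
  qed
  also have "\<dots> = of_nat (card (?T k)) * (of_nat p ^ w - of_nat p ^ k)" by simp
  finally show ?case using Suc by simp
qed

text \<open>Double counting: every ordered independent \<open>k\<close>-tuple of \<open>G\<close> generates exactly one subgroup
  of order \<open>p ^ k\<close>, and is an ordered independent \<open>k\<close>-tuple of that subgroup.\<close>

lemma card_subgroups_of_order:
  assumes "order G = p ^ n"
  shows "rat_of_nat (card {W. subgroup W G \<and> card W = p ^ k}) = gauss_binomial p n k"
proof -
  let ?T = "\<lambda>W. {xs. set xs \<subseteq> W \<and> length xs = k \<and> indep xs}"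
  let ?S = "{W. subgroup W G \<and> card W = p ^ k}"
  have finS: "finite ?S" using finite_subgroups by (rule rev_finite_subset) auto
  have finT: "finite (?T W)" if "W \<in> ?S" for W
    using that
    by (intro finite_subset[OF _ finite_lists_length_eq[OF finite_subgroup, of W k]]) auto
  have gen: "generate G (set xs) = W" if "W \<in> ?S" "xs \<in> ?T W" for W xs
    using that indep_card_generate[of xs]
    by (intro card_subset_eq generate_subgroup_incl finite_subgroup) auto
  have "?T (carrier G) = (\<Union>W\<in>?S. ?T W)"
  proof (intro equalityI subsetI)
    fix xs assume xs: "xs \<in> ?T (carrier G)"
    hence "generate G (set xs) \<in> ?S" "xs \<in> ?T (generate G (set xs))"
      using indep_card_generate[of xs] by (auto intro: generate_is_subgroup generate.incl)
    thus "xs \<in> (\<Union>W\<in>?S. ?T W)" by blast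
  qed (auto dest: subgroup.subset)
  moreover have "card (\<Union>W\<in>?S. ?T W) = (\<Sum>W\<in>?S. card (?T W))"
    by (rule card_UN_disjoint) (use finS finT gen in blast)+
  ultimately have "rat_of_nat (card (?T (carrier G))) = (\<Sum>W\<in>?S. rat_of_nat (card (?T W)))"
    by simp
  also have "\<dots> = (\<Sum>W\<in>?S. \<Prod>i<k. of_nat p ^ k - of_nat p ^ i)"
    by (rule sum.cong[OF refl], rule card_indep_lists) auto
  finally have "(\<Prod>i<k. of_nat p ^ n - of_nat p ^ i) =
      rat_of_nat (card ?S) * (\<Prod>i<k. of_nat p ^ k - of_nat p ^ i)"
    using card_indep_lists[OF subgroup_self, of n k] assms by (simp add: order_def)
  moreover have "(\<Prod>i<k. rat_of_nat p ^ k - of_nat p ^ i) \<noteq> 0"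
    using p_gt_1 by simp
  ultimately show ?thesis
    unfolding gauss_binomial_def by (simp add: field_simps)
qed

section \<open>Hyperplanes and their intersections\<close>

text \<open>Take \<open>M\<close> maximal among the subgroups containing \<open>W\<close> and
  avoiding \<open>x\<close>. Adjoining any \<open>y\<close> outside \<open>M\<close> captures
  \<open>x\<close>; comparing orders, adjoining \<open>x\<close> captures \<open>y\<close>. Hence
  \<open>M\<close> and \<open>x\<close> generate everything and \<open>M\<close> has index
  \<open>p\<close>.\<close>

lemma exists_hyperplane_avoiding:
  assumes W: "subgroup W G" and x: "x \<in> carrier G" "x \<notin> W"
  obtains M where "hyperplane M" "W \<subseteq> M" "x \<notin> M"
proof -
  have fin: "finite {U. subgroup U G \<and> W \<subseteq> U \<and> x \<notin> U}"
    using finite_subgroups by (rule rev_finite_subset) auto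
  obtain M where M: "subgroup M G" "W \<subseteq> M" "x \<notin> M"
    and max: "\<And>U. \<lbrakk>subgroup U G; W \<subseteq> U; x \<notin> U; M \<subseteq> U\<rbrakk> \<Longrightarrow> U = M"
  proof -
    have "W \<in> {U. subgroup U G \<and> W \<subseteq> U \<and> x \<notin> U}" using assms by simp
    then obtain M where "M \<in> {U. subgroup U G \<and> W \<subseteq> U \<and> x \<notin> U}"
      "\<forall>U \<in> {U. subgroup U G \<and> W \<subseteq> U \<and> x \<notin> U}. M \<subseteq> U \<longrightarrow> M = U"
      using finite_has_maximal[OF fin] by (metis (no_types, lifting) empty_iff)
    thus thesis by (intro that[of M]) auto
  qed
  let ?X = "generate G (insert x M)"
  have "y \<in> ?X" if y: "y \<in> carrier G" for y
  proof (cases "y \<in> M")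
    case True thus ?thesis by (auto intro: generate.incl)
  next
    case False
    let ?Y = "generate G (insert y M)"
    have sY: "subgroup ?Y G" using y M(1) subgroup.subset by (intro generate_is_subgroup) blast
    have MY: "M \<subseteq> ?Y" "y \<in> ?Y" by (auto intro: generate.incl)
    hence "x \<in> ?Y" using max[OF sY] M False by blast
    hence "?X \<subseteq> ?Y" using MY by (intro generate_subgroup_incl[OF _ sY]) auto
    hence "?X = ?Y"
      using card_insert_subgroup[OF M(1) y False] card_insert_subgroup[OF M(1) x(1) M(3)]
      by (intro card_subset_eq finite_subgroup[OF sY]) auto
    thus ?thesis using MY by simp
  qed
  hence "?X = carrier G"
    using generate_incl[of "insert x M"] x subgroup.subset[OF M(1)] by auto
  hence "order G = p * card M"
    using card_insert_subgroup[OF M(1) x(1) M(3)] by (simp add: order_def)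
  thus ?thesis using that M by blast
qed

text \<open>For \<open>x\<close> in \<open>W\<close> outside \<open>M\<close>, every element of the
  group is some \<open>h \<otimes> x [^] i\<close> with \<open>h\<close> in \<open>M\<close> and
  \<open>i < p\<close>. If the product lies in \<open>W\<close>, so does \<open>h\<close>, and at
  most \<open>p\<close> cosets of \<open>W \<inter> M\<close> cover \<open>W\<close>.\<close>

lemma card_le_Int_hyperplane:
  assumes W: "subgroup W G" and M: "hyperplane M"
  shows "card W \<le> p * card (W \<inter> M)"
proof (cases "W \<subseteq> M")
  case True thus ?thesis using p_gt_1 by (simp add: Int_absorb2)
next
  case False
  then obtain x where x: "x \<in> W" "x \<notin> M" by auto
  have xG: "x \<in> carrier G" using x W by (rule_tac subgroup.mem_carrier)
  have sM: "subgroup M G" using M by simp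
  have MG: "M \<subseteq> carrier G" using sM by (rule subgroup.subset)
  have "generate G (insert x M) = carrier G"
    using card_insert_subgroup[OF sM xG x(2)] M xG MG
    by (intro card_subset_eq finite_carrier generate_incl) (auto simp: order_def)
  hence cover: "carrier G \<subseteq> (\<lambda>(h, i). h \<otimes> x [^] i) ` (M \<times> {..<p})"
    using generate_insert_normal_subset[of M x p] sM xG exponent[OF xG] subgroup.one_closed[OF sM] p_gt_1
    by (simp add: normal_iff_subgroup)
  have "W \<subseteq> (\<lambda>(h, i). h \<otimes> x [^] i) ` ((W \<inter> M) \<times> {..<p})"
  proof
    fix y assume y: "y \<in> W"
    have "y \<in> carrier G" using y W by (rule_tac subgroup.mem_carrier)
    then obtain h and i :: nat where hi: "h \<in> M" "i < p" "y = h \<otimes> x [^] i" using cover by auto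
    have xi: "x [^] i \<in> W" using subgroup_int_pow_closed[OF W x(1), of "int i"] by (simp add: int_pow_int)
    have "h = y \<otimes> inv (x [^] i)" using hi MG xG by (auto simp: m_assoc)
    hence "h \<in> W" using y xi W by (simp add: subgroup.m_closed subgroup.m_inv_closed)
    thus "y \<in> (\<lambda>(h, i). h \<otimes> x [^] i) ` ((W \<inter> M) \<times> {..<p})" using hi by auto
  qed
  hence "card W \<le> card ((W \<inter> M) \<times> {..<p})"
    using finite_subgroup[OF W] by (intro surj_card_le) auto
  thus ?thesis by (simp add: card_cartesian_product mult.commute)
qed

text \<open>Bounds the codimension of an intersection by the number of hyperplanes. The carrier is
  included so that the empty family yields the whole group and not the whole type.\<close>

lemma order_le_Inter_hyperplanes:
  assumes "finite \<S>" "\<And>M. M \<in> \<S> \<Longrightarrow> hyperplane M"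
  shows "subgroup (carrier G \<inter> \<Inter>\<S>) G \<and> order G \<le> p ^ card \<S> * card (carrier G \<inter> \<Inter>\<S>)"
  using assms
proof (induction \<S>)
  case empty
  show ?case by (simp add: order_def subgroup_self)
next
  case (insert M \<S>)
  let ?W = "carrier G \<inter> \<Inter>\<S>"
  have eq: "carrier G \<inter> \<Inter>(insert M \<S>) = ?W \<inter> M" by auto
  have IH: "subgroup ?W G" "order G \<le> p ^ card \<S> * card ?W" using insert by auto
  have "p ^ card \<S> * card ?W \<le> p ^ card \<S> * (p * card (?W \<inter> M))"
    using card_le_Int_hyperplane[OF IH(1), of M] insert by (intro mult_left_mono) auto
  also have "\<dots> = p ^ card (insert M \<S>) * card (?W \<inter> M)" using insert(1,2) by simp
  finally have "order G \<le> p ^ card (insert M \<S>) * card (?W \<inter> M)"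
    using IH(2) by (rule_tac order_trans)
  moreover have "subgroup (?W \<inter> M) G"
    by (rule subgroups_Inter_pair[OF IH(1)]) (use insert in auto)
  ultimately show ?case unfolding eq by simp
qed

text \<open>Induction on the codimension: enlarge \<open>W\<close> by one element \<open>x\<close>,
  describe the larger subgroup by \<open>j\<close> hyperplanes, and cut it down with one more that
  contains \<open>W\<close> but misses \<open>x\<close>.\<close>

lemma exists_hyperplanes_Inter:
  assumes "subgroup W G" "order G = p ^ j * card W"
  shows "\<exists>\<S>. finite \<S> \<and> card \<S> = j \<and> (\<forall>M\<in>\<S>. hyperplane M) \<and> carrier G \<inter> \<Inter>\<S> = W"
  using assms
proof (induction j arbitrary: W)
  case 0
  hence "W = carrier G"
    by (intro card_subset_eq finite_carrier subgroup.subset) (auto simp: order_def)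
  thus ?case by (intro exI[of _ "{}"]) auto
next
  case (Suc j)
  have "card W > 0" by (rule subgroup.finite_imp_card_positive[OF Suc(2) finite_carrier])
  moreover have "1 < p ^ Suc j" using p_gt_1 by (rule one_less_power) simp
  ultimately have "card W < order G" using Suc(3) by simp
  hence "W \<noteq> carrier G" by (auto simp: order_def)
  then obtain x where x: "x \<in> carrier G" "x \<notin> W" using subgroup.subset[OF Suc(2)] by auto
  let ?X = "generate G (insert x W)"
  have sX: "subgroup ?X G" using x subgroup.subset[OF Suc(2)] by (intro generate_is_subgroup) auto
  have WX: "W \<subseteq> ?X" "x \<in> ?X" by (auto intro: generate.incl)
  have cX: "card ?X = p * card W" by (rule card_insert_subgroup[OF Suc(2) x])
  obtain \<S> where S: "finite \<S>" "card \<S> = j" "\<forall>M\<in>\<S>. hyperplane M" "carrier G \<inter> \<Inter>\<S> = ?X"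
    using Suc(1)[OF sX] Suc(3) cX by (auto simp: mult_ac)
  obtain M where M: "hyperplane M" "W \<subseteq> M" "x \<notin> M"
    by (rule exists_hyperplane_avoiding[OF Suc(2) x])
  \<comment> \<open>All members of the family contain \<open>x\<close> and \<open>M\<close> does
    not, so the family really grows by one.\<close>
  have "M \<notin> \<S>" using S(4) WX M(3) by auto
  have fX: "finite ?X" by (rule finite_subgroup[OF sX])
  have sI: "subgroup (?X \<inter> M) G" using sX M by (intro subgroups_Inter_pair) auto
  \<comment> \<open>The intersection misses \<open>x\<close>, so it is proper in \<open>?X\<close>
    and no larger than \<open>W\<close>, which it contains.\<close>
  have "p * card (?X \<inter> M) \<le> card ?X"
    by (rule card_subgroup_less_p_group(1)[OF prime p_group sI sX]) (use WX M in auto)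
  hence "card (?X \<inter> M) \<le> card W" using cX p_gt_1 by simp
  moreover have "W \<subseteq> ?X \<inter> M" using WX M by auto
  ultimately have "W = ?X \<inter> M" using fX by (intro card_seteq) auto
  hence "carrier G \<inter> \<Inter>(insert M \<S>) = W" using S(4) by auto
  thus ?case using S M \<open>M \<notin> \<S>\<close> by (intro exI[of _ "insert M \<S>"]) auto
qed

text \<open>The left side is the group-theoretic mirror of \<open>has_compositum_number\<close>,
  with intersections in place of composita. The least number of hyperplanes is the codimension, by
  the two preceding lemmas.\<close>

lemma Inter_hyperplanes_iff:
  assumes W: "subgroup W G" and n: "order G = p ^ n" and k: "k \<le> n"
  shows "((\<exists>\<S>. finite \<S> \<and> card \<S> = n - k \<and> (\<forall>M\<in>\<S>. hyperplane M) \<and> carrier G \<inter> \<Inter>\<S> = W) \<and>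
    (\<forall>j<n - k. \<not> (\<exists>\<S>. finite \<S> \<and> card \<S> = j \<and> (\<forall>M\<in>\<S>. hyperplane M) \<and> carrier G \<inter> \<Inter>\<S> = W)))
    \<longleftrightarrow> card W = p ^ k"
proof -
  let ?P = "\<lambda>j. \<exists>\<S>. finite \<S> \<and> card \<S> = j \<and> (\<forall>M\<in>\<S>. hyperplane M) \<and> carrier G \<inter> \<Inter>\<S> = W"
  \<comment> \<open>If \<open>c\<close> is the least number with property \<open>Q\<close>, then
    being least characterizes \<open>c\<close>.\<close>
  have *: "(Q b \<and> (\<forall>j<b. \<not> Q j)) \<longleftrightarrow> b = c"
    if "Q c" "\<And>j. Q j \<Longrightarrow> c \<le> j" for Q and b c :: nat
  proof (intro iffI conjI allI impI)
    assume "Q b \<and> (\<forall>j<b. \<not> Q j)"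
    thus "b = c" using that by (meson le_antisym leI)
  qed (use that in \<open>auto dest: leD\<close>)
  obtain a where a: "card W = p ^ a" by (rule card_subgroup_p_group[OF prime p_group W])
  have "card W \<le> order G"
    unfolding order_def by (intro card_mono finite_carrier subgroup.subset[OF W])
  hence an: "a \<le> n" using a n p_gt_1 by simp
  have "?P (n - a)"
  proof (rule exists_hyperplanes_Inter[OF W])
    show "order G = p ^ (n - a) * card W"
      unfolding n a power_add[symmetric] using an by simp
  qed
  moreover have "n - a \<le> j" if "?P j" for j
  proof -
    obtain \<S> where S: "finite \<S>" "card \<S> = j" "\<forall>M\<in>\<S>. hyperplane M" "carrier G \<inter> \<Inter>\<S> = W"
      using \<open>?P j\<close> by blast
    have "order G \<le> p ^ card \<S> * card (carrier G \<inter> \<Inter>\<S>)"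
      using order_le_Inter_hyperplanes[OF S(1)] S(3) by blast
    hence "p ^ n \<le> p ^ (j + a)" unfolding n S(2,4) a power_add .
    hence "n \<le> j + a" using p_gt_1 by simp
    thus ?thesis by simp
  qed
  ultimately have "(?P (n - k) \<and> (\<forall>j<n - k. \<not> ?P j)) \<longleftrightarrow> n - k = n - a"
    by (rule_tac Q = ?P in *)
  \<comment> \<open>Truncated subtraction from \<open>n\<close> is injective only up to
    \<open>n\<close>, hence the appeal to both bounds.\<close>
  also have "\<dots> \<longleftrightarrow> a = k" using an k by auto
  also have "\<dots> \<longleftrightarrow> card W = p ^ k" using a p_gt_1 by simp
  finally show ?thesis .
qed

end

section \<open>Galois groups and the independence of automorphisms\<close>

text \<open>Dedekind's lemma. Given \<open>\<rho>\<close> other than \<open>\<beta>\<close>, choose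
  \<open>f\<close> on which they differ, replace \<open>e\<close> by \<open>f \<otimes> e\<close> in
  the relation and subtract \<open>\<beta> f\<close> times the original: the term of
  \<open>\<beta>\<close> disappears. Extensionality guarantees that distinct functions differ at
  some element of the carrier.\<close>

lemma (in domain) ring_homs_independent:
  assumes "finite S" and "S \<subseteq> ring_hom R R" and "S \<subseteq> extensional (carrier R)"
    and "c \<in> S \<rightarrow> carrier R"
    and "\<And>e. e \<in> carrier R \<Longrightarrow> (\<Oplus>\<alpha>\<in>S. c \<alpha> \<otimes> \<alpha> e) = \<zero>"
    and "\<alpha> \<in> S"
  shows "c \<alpha> = \<zero>"
  using assms
proof (induction S arbitrary: c \<alpha>)
  case empty
  then show ?case by simp
next
  case (insert \<beta> S)
  have cl: "\<rho> e \<in> carrier R" if "\<rho> \<in> insert \<beta> S" "e \<in> carrier R" for \<rho> e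
    using that insert.prems(1) by (auto intro: ring_hom_closed)
  have mult: "\<rho> (e \<otimes> f) = \<rho> e \<otimes> \<rho> f" if "\<rho> \<in> insert \<beta> S" "e \<in> carrier R" "f \<in> carrier R" for \<rho> e f
    using that insert.prems(1) by (auto intro: ring_hom_mult)
  have c: "c \<rho> \<in> carrier R" if "\<rho> \<in> insert \<beta> S" for \<rho>
    using that insert.prems(3) by auto
  define g where "g e = (\<Oplus>\<alpha>\<in>S. c \<alpha> \<otimes> \<alpha> e)" for e
  have g_closed: "g e \<in> carrier R" if "e \<in> carrier R" for e
    unfolding g_def using that cl c by (intro finsum_closed) auto
  have sum: "c \<beta> \<otimes> \<beta> e \<oplus> g e = \<zero>" if "e \<in> carrier R" for e
  proof -
    have "(\<Oplus>\<alpha>\<in>insert \<beta> S. c \<alpha> \<otimes> \<alpha> e) = c \<beta> \<otimes> \<beta> e \<oplus> g e"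
      unfolding g_def using that cl c insert.hyps by (intro finsum_insert) auto
    thus ?thesis using insert.prems(4)[OF that] by simp
  qed
  have zero: "c \<rho> = \<zero>" if \<rho>: "\<rho> \<in> S" for \<rho>
  proof -
    have "\<rho> \<noteq> \<beta>" using \<rho> insert.hyps by auto
    then obtain f where f: "f \<in> carrier R" "\<rho> f \<noteq> \<beta> f"
      using \<rho> insert.prems(2) extensionalityI[of \<rho> "carrier R" \<beta>] by auto
    \<comment> \<open>The coefficients after elimination of \<open>\<beta>\<close>; the one at
      \<open>\<rho>\<close> vanishes only if \<open>c \<rho>\<close> does, by the choice of
      \<open>f\<close>.\<close>
    define d where "d \<alpha> = c \<alpha> \<otimes> (\<alpha> f \<ominus> \<beta> f)" for \<alpha>
    have d: "d \<in> S \<rightarrow> carrier R" unfolding d_def using c cl f by auto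
    have "(\<Oplus>\<alpha>\<in>S. d \<alpha> \<otimes> \<alpha> e) = \<zero>" if e: "e \<in> carrier R" for e
    proof -
      have "(\<Oplus>\<alpha>\<in>S. d \<alpha> \<otimes> \<alpha> e) = (\<Oplus>\<alpha>\<in>S. c \<alpha> \<otimes> \<alpha> (f \<otimes> e) \<oplus> (\<ominus> \<beta> f) \<otimes> (c \<alpha> \<otimes> \<alpha> e))"
      proof (rule finsum_cong'[OF refl])
        fix \<alpha> assume \<alpha>: "\<alpha> \<in> S"
        hence "c \<alpha> \<in> carrier R" "\<alpha> e \<in> carrier R" "\<alpha> f \<in> carrier R" "\<beta> f \<in> carrier R"
          using c cl e f by auto
        thus "d \<alpha> \<otimes> \<alpha> e = c \<alpha> \<otimes> \<alpha> (f \<otimes> e) \<oplus> (\<ominus> \<beta> f) \<otimes> (c \<alpha> \<otimes> \<alpha> e)"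
          using mult[of \<alpha> f e] \<alpha> e f unfolding d_def by (simp add: minus_eq, algebra)
      qed (use c cl e f in auto)
      also have "\<dots> = g (f \<otimes> e) \<oplus> (\<ominus> \<beta> f) \<otimes> g e"
      proof -
        have "(\<Oplus>\<alpha>\<in>S. (\<ominus> \<beta> f) \<otimes> (c \<alpha> \<otimes> \<alpha> e)) = (\<ominus> \<beta> f) \<otimes> g e"
          unfolding g_def using c cl e f insert.hyps by (intro finsum_rdistr[symmetric]) auto
        moreover have "(\<Oplus>\<alpha>\<in>S. c \<alpha> \<otimes> \<alpha> (f \<otimes> e) \<oplus> (\<ominus> \<beta> f) \<otimes> (c \<alpha> \<otimes> \<alpha> e)) =
            g (f \<otimes> e) \<oplus> (\<Oplus>\<alpha>\<in>S. (\<ominus> \<beta> f) \<otimes> (c \<alpha> \<otimes> \<alpha> e))"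
          unfolding g_def using c cl e f by (intro finsum_addf) auto
        ultimately show ?thesis by simp
      qed
      also have "g (f \<otimes> e) = \<ominus> (c \<beta> \<otimes> (\<beta> f \<otimes> \<beta> e))"
        using sum[of "f \<otimes> e"] e f c cl g_closed mult[of \<beta> f e]
        by (metis insertI1 m_closed minus_equality a_comm)
      also have "g e = \<ominus> (c \<beta> \<otimes> \<beta> e)"
        using sum[of e] e c cl g_closed by (metis insertI1 m_closed minus_equality a_comm)
      also have "\<ominus> (c \<beta> \<otimes> (\<beta> f \<otimes> \<beta> e)) \<oplus> (\<ominus> \<beta> f) \<otimes> (\<ominus> (c \<beta> \<otimes> \<beta> e)) = \<zero>"
        using c[of \<beta>] cl[of \<beta> e] cl[of \<beta> f] e f by (simp, algebra)
      finally show ?thesis .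
    qed
    hence "d \<rho> = \<zero>" using insert.IH[OF _ _ d _ \<rho>] insert.prems(1,2) by auto
    hence "c \<rho> = \<zero> \<or> \<rho> f \<ominus> \<beta> f = \<zero>"
      unfolding d_def using c cl \<rho> f by (simp add: integral_iff)
    thus ?thesis using cl \<rho> f by (simp add: r_right_minus_eq)
  qed
  hence "g \<one> = (\<Oplus>\<alpha>\<in>S. \<zero>)"
    unfolding g_def using cl by (intro finsum_cong') auto
  hence "g \<one> = \<zero>" by simp
  moreover have "\<beta> \<one> = \<one>" using insert.prems(1) by (auto intro: ring_hom_one)
  ultimately have "c \<beta> = \<zero>" using sum[OF one_closed] c by simp
  thus ?case using zero insert.prems(5) by auto
qed

section \<open>Galois groups inside the group of bijections\<close>

lemma galois_group_carrier_iff: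
  "\<alpha> \<in> carrier (galois_group R K) \<longleftrightarrow>
    \<alpha> \<in> ring_hom R R \<and> \<alpha> \<in> Bij (carrier R) \<and> (\<forall>x\<in>K. \<alpha> x = x)"
  by (auto simp: galois_group_def)

lemma galois_group_eq_subgroup:
  "galois_group R K = BijGroup (carrier R)\<lparr>carrier := carrier (galois_group R K)\<rparr>"
  by (simp add: galois_group_def)

lemma BijGroup_mult_apply:
  assumes "\<alpha> \<in> Bij S" "\<beta> \<in> Bij S" "x \<in> S"
  shows "(\<alpha> \<otimes>\<^bsub>BijGroup S\<^esub> \<beta>) x = \<alpha> (\<beta> x)"
  using assms by (simp add: BijGroup_def compose_def)

lemma carrier_BijGroup: "carrier (BijGroup S) = Bij S"
  by (simp add: BijGroup_def)

lemma BijGroup_one_apply: "x \<in> S \<Longrightarrow> \<one>\<^bsub>BijGroup S\<^esub> x = x"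
  by (simp add: BijGroup_def)

lemma BijGroup_inv_apply:
  assumes "\<alpha> \<in> Bij S" "x \<in> S"
  shows "(inv\<^bsub>BijGroup S\<^esub> \<alpha>) (\<alpha> x) = x" "\<alpha> ((inv\<^bsub>BijGroup S\<^esub> \<alpha>) x) = x"
proof -
  interpret group "BijGroup S" by (rule group_BijGroup)
  have \<alpha>: "\<alpha> \<in> carrier (BijGroup S)" using assms by (simp add: carrier_BijGroup)
  have inv: "inv\<^bsub>BijGroup S\<^esub> \<alpha> \<in> Bij S" using inv_closed[OF \<alpha>] by (simp add: carrier_BijGroup)
  show "(inv\<^bsub>BijGroup S\<^esub> \<alpha>) (\<alpha> x) = x"
    using BijGroup_mult_apply[OF inv assms] l_inv[OF \<alpha>] assms by (simp add: BijGroup_one_apply)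
  show "\<alpha> ((inv\<^bsub>BijGroup S\<^esub> \<alpha>) x) = x"
    using BijGroup_mult_apply[OF assms(1) inv assms(2)] r_inv[OF \<alpha>] assms by (simp add: BijGroup_one_apply)
qed

text \<open>Stated for arbitrary subsets: the empty set gives all automorphisms, and a singleton
  gives the stabilizer of an element.\<close>

lemma (in ring) subgroup_galois_group:
  assumes "K \<subseteq> carrier R"
  shows "subgroup (carrier (galois_group R K)) (BijGroup (carrier R))"
proof (rule group.subgroupI[OF group_BijGroup])
  let ?B = "BijGroup (carrier R)"
  show "carrier (galois_group R K) \<subseteq> carrier ?B"
    by (auto simp: galois_group_carrier_iff carrier_BijGroup)
  have "(\<lambda>x\<in>carrier R. x) \<in> carrier (galois_group R K)"
    using assms by (auto simp: galois_group_carrier_iff id_Bij intro!: ring_hom_memI)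
  thus "carrier (galois_group R K) \<noteq> {}" by auto
next
  let ?B = "BijGroup (carrier R)"
  fix \<alpha> assume "\<alpha> \<in> carrier (galois_group R K)"
  hence \<alpha>: "\<alpha> \<in> ring_hom R R" "\<alpha> \<in> Bij (carrier R)" "\<forall>x\<in>K. \<alpha> x = x"
    by (auto simp: galois_group_carrier_iff)
  have inv: "inv\<^bsub>?B\<^esub> \<alpha> \<in> Bij (carrier R)"
    using \<alpha>(2) group.inv_closed[OF group_BijGroup, of \<alpha> "carrier R"] by (simp add: carrier_BijGroup)
  \<comment> \<open>Injectivity of \<open>\<alpha>\<close>: the ring laws for the inverse are
    checked after applying \<open>\<alpha>\<close>, where they become those of
    \<open>\<alpha>\<close> itself.\<close>
  have eqI: "x = y" if "x \<in> carrier R" "y \<in> carrier R" "\<alpha> x = \<alpha> y" for x y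
    using that \<alpha>(2) BijGroup_inv_apply(1) by metis
  have cl: "(inv\<^bsub>?B\<^esub> \<alpha>) x \<in> carrier R" if "x \<in> carrier R" for x
    using that Bij_imp_funcset[OF inv] by auto
  note app = BijGroup_inv_apply[OF \<alpha>(2)]
  have "inv\<^bsub>?B\<^esub> \<alpha> \<in> ring_hom R R"
    by (rule ring_hom_memI; (rule eqI)?)
      (use cl app in \<open>simp_all add: ring_hom_mult[OF \<alpha>(1)] ring_hom_add[OF \<alpha>(1)] ring_hom_one[OF \<alpha>(1)]
        ring_hom_closed[OF \<alpha>(1)]\<close>)
  moreover have "(inv\<^bsub>?B\<^esub> \<alpha>) x = x" if "x \<in> K" for x
    using that assms \<alpha>(3) app(1)[of x] by auto
  ultimately show "inv\<^bsub>?B\<^esub> \<alpha> \<in> carrier (galois_group R K)"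
    using inv by (simp add: galois_group_carrier_iff)
next
  let ?B = "BijGroup (carrier R)"
  fix \<alpha> \<beta> assume "\<alpha> \<in> carrier (galois_group R K)" "\<beta> \<in> carrier (galois_group R K)"
  hence \<alpha>: "\<alpha> \<in> ring_hom R R" "\<alpha> \<in> Bij (carrier R)" "\<forall>x\<in>K. \<alpha> x = x"
    and \<beta>: "\<beta> \<in> ring_hom R R" "\<beta> \<in> Bij (carrier R)" "\<forall>x\<in>K. \<beta> x = x"
    by (auto simp: galois_group_carrier_iff)
  note app = BijGroup_mult_apply[OF \<alpha>(2) \<beta>(2)]
  have "\<alpha> \<otimes>\<^bsub>?B\<^esub> \<beta> \<in> ring_hom R R"
    by (rule ring_hom_memI)
      (simp_all add: app ring_hom_mult[OF \<alpha>(1)] ring_hom_add[OF \<alpha>(1)] ring_hom_one[OF \<alpha>(1)]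
        ring_hom_closed[OF \<alpha>(1)] ring_hom_mult[OF \<beta>(1)] ring_hom_add[OF \<beta>(1)] ring_hom_one[OF \<beta>(1)]
        ring_hom_closed[OF \<beta>(1)])
  moreover have "\<alpha> \<otimes>\<^bsub>?B\<^esub> \<beta> \<in> Bij (carrier R)"
    using group.is_monoid[OF group_BijGroup] monoid.m_closed \<alpha>(2) \<beta>(2)
    by (metis carrier_BijGroup)
  moreover have "(\<alpha> \<otimes>\<^bsub>?B\<^esub> \<beta>) x = x" if "x \<in> K" for x
    using that app[of x] assms \<alpha>(3) \<beta>(3) by auto
  ultimately show "\<alpha> \<otimes>\<^bsub>?B\<^esub> \<beta> \<in> carrier (galois_group R K)"
    by (simp add: galois_group_carrier_iff)
qed

lemma (in ring) group_galois_group: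
  assumes "K \<subseteq> carrier R"
  shows "group (galois_group R K)"
  using group.subgroup_imp_group[OF group_BijGroup subgroup_galois_group[OF assms]]
  by (simp flip: galois_group_eq_subgroup)

text \<open>The base field is not a parameter but the fixed field of \<open>H\<close>. The locale
  thus serves for L and for K_\<phi>, and for each subgroup of their Galois groups.\<close>

locale finite_automorphism_group = field R for R (structure) +
  fixes H :: "('a \<Rightarrow> 'a) set"
  assumes subgroup_BijGroup: "subgroup H (BijGroup (carrier R))"
    and ring_homs: "H \<subseteq> ring_hom R R"
    and finite_group: "finite H"
begin

abbreviation amult (infixl \<open>\<cdot>\<close> 70) where "\<alpha> \<cdot> \<beta> \<equiv> \<alpha> \<otimes>\<^bsub>BijGroup (carrier R)\<^esub> \<beta>"
abbreviation ainv where "ainv \<alpha> \<equiv> inv\<^bsub>BijGroup (carrier R)\<^esub> \<alpha>"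

sublocale B: group "BijGroup (carrier R)" by (rule group_BijGroup)

lemma Bij: "\<alpha> \<in> H \<Longrightarrow> \<alpha> \<in> Bij (carrier R)"
  using subgroup.subset[OF subgroup_BijGroup] by (auto simp: carrier_BijGroup)

lemma closed: "\<alpha> \<in> H \<Longrightarrow> x \<in> carrier R \<Longrightarrow> \<alpha> x \<in> carrier R"
  using Bij_imp_funcset[OF Bij] by auto

lemma hom: "\<alpha> \<in> H \<Longrightarrow> ring_hom_cring R R \<alpha>"
  using ring_homs by (intro ring_hom_cringI ring_hom_ringI2 is_cring ring_axioms) auto

lemma mult_apply: "\<alpha> \<in> H \<Longrightarrow> \<beta> \<in> H \<Longrightarrow> x \<in> carrier R \<Longrightarrow> (\<alpha> \<cdot> \<beta>) x = \<alpha> (\<beta> x)"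
  by (intro BijGroup_mult_apply Bij)

lemma mult_mem: "\<alpha> \<in> H \<Longrightarrow> \<beta> \<in> H \<Longrightarrow> \<alpha> \<cdot> \<beta> \<in> H"
  by (rule subgroup.m_closed[OF subgroup_BijGroup])

lemma inv_mem: "\<alpha> \<in> H \<Longrightarrow> ainv \<alpha> \<in> H"
  by (rule subgroup.m_inv_closed[OF subgroup_BijGroup])

lemma inv_apply:
  assumes "\<alpha> \<in> H" "x \<in> carrier R"
  shows "ainv \<alpha> (\<alpha> x) = x" "\<alpha> (ainv \<alpha> x) = x"
  using BijGroup_inv_apply[OF Bij] assms by auto

lemma mem_carrier: "\<alpha> \<in> H \<Longrightarrow> \<alpha> \<in> carrier (BijGroup (carrier R))"
  by (rule subgroup.mem_carrier[OF subgroup_BijGroup])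

lemma left_translate: "\<beta> \<in> H \<Longrightarrow> (\<lambda>\<alpha>. \<beta> \<cdot> \<alpha>) ` H = H" "\<beta> \<in> carrier (BijGroup (carrier R)) \<Longrightarrow> inj_on (\<lambda>\<alpha>. \<beta> \<cdot> \<alpha>) H"
proof -
  show inj: "inj_on (\<lambda>\<alpha>. \<beta> \<cdot> \<alpha>) H" if "\<beta> \<in> carrier (BijGroup (carrier R))" for \<beta>
    using that mem_carrier by (auto intro!: inj_onI)
  show "(\<lambda>\<alpha>. \<beta> \<cdot> \<alpha>) ` H = H" if "\<beta> \<in> H"
    using that mult_mem by (intro endo_inj_surj finite_group inj mem_carrier) auto
qed

section \<open>Traces and Artin's theorem\<close>

definition tr :: "'a \<Rightarrow> 'a" where "tr z = (\<Oplus>\<alpha>\<in>H. \<alpha> z)"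

lemma tr_closed: "z \<in> carrier R \<Longrightarrow> tr z \<in> carrier R"
  unfolding tr_def using closed by (intro finsum_closed) auto

text \<open>Here \<open>\<beta>\<close> need not come from \<open>H\<close>: in
  \<open>galois_group_fixed_field\<close> its membership is the point at issue.\<close>

lemma apply_tr:
  assumes \<beta>: "\<beta> \<in> Bij (carrier R)" "\<beta> \<in> ring_hom R R" and z: "z \<in> carrier R"
  shows "\<beta> (tr z) = (\<Oplus>\<alpha>\<in>H. (\<beta> \<cdot> \<alpha>) z)"
proof -
  interpret \<beta>: ring_hom_cring R R \<beta>
    using \<beta> by (intro ring_hom_cringI ring_hom_ringI2 is_cring ring_axioms) auto
  have "\<beta> (tr z) = (\<Oplus>\<alpha>\<in>H. (\<beta> \<circ> (\<lambda>\<alpha>. \<alpha> z)) \<alpha>)"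
    unfolding tr_def using z closed by (intro \<beta>.hom_finsum) auto
  also have "\<dots> = (\<Oplus>\<alpha>\<in>H. (\<beta> \<cdot> \<alpha>) z)"
    using z closed \<beta>.hom_closed BijGroup_mult_apply[OF \<beta>(1) Bij] by (intro finsum_cong') auto
  finally show ?thesis .
qed

lemma tr_fixed: "z \<in> carrier R \<Longrightarrow> tr z \<in> fixed_field R H"
proof -
  assume z: "z \<in> carrier R"
  have "\<beta> (tr z) = tr z" if \<beta>: "\<beta> \<in> H" for \<beta>
  proof -
    have "\<beta> (tr z) = (\<Oplus>\<alpha>\<in>H. (\<beta> \<cdot> \<alpha>) z)"
      using \<beta> z ring_homs by (intro apply_tr Bij) auto
    also have "\<dots> = (\<Oplus>\<alpha>\<in>(\<lambda>\<alpha>. \<beta> \<cdot> \<alpha>) ` H. \<alpha> z)"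
      using left_translate \<beta> closed z mult_mem mem_carrier by (intro finsum_reindex[symmetric]) auto
    also have "\<dots> = tr z" using left_translate(1)[OF \<beta>] by (simp add: tr_def)
    finally show ?thesis .
  qed
  thus ?thesis using tr_closed[OF z] by (simp add: fixed_field_def)
qed

lemma extensional: "H \<subseteq> extensional (carrier R)"
  using Bij Bij_imp_extensional by blast

lemma H_nonempty: "H \<noteq> {}"
  using subgroup.one_closed[OF subgroup_BijGroup] by auto

text \<open>The trace is not identically zero by independence with all coefficients one, and it is
  linear over the fixed field, so a single nonzero value can be scaled to any
  \<open>x\<close>.\<close>

lemma fixed_field_eq_range_tr:
  assumes "x \<in> fixed_field R H"
  obtains z where "z \<in> carrier R" "tr z = x"
proof -
  have "\<exists>z\<in>carrier R. tr z \<noteq> \<zero>"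
  proof (rule ccontr)
    assume "\<not> ?thesis"
    hence "(\<Oplus>\<alpha>\<in>H. \<one> \<otimes> \<alpha> e) = \<zero>" if "e \<in> carrier R" for e
      using that closed unfolding tr_def by (metis (no_types, lifting) finsum_cong' Pi_I l_one)
    hence "\<one> = \<zero>"
      using ring_homs_independent[OF finite_group ring_homs extensional, of "\<lambda>_. \<one>"] H_nonempty by auto
    thus False by simp
  qed
  then obtain z where z: "z \<in> carrier R" "tr z \<noteq> \<zero>" by auto
  have x: "x \<in> carrier R" "\<And>\<alpha>. \<alpha> \<in> H \<Longrightarrow> \<alpha> x = x" using assms by (auto simp: fixed_field_def)
  define t where "t = inv (tr z)"
  have t: "t \<in> carrier R" "tr z \<otimes> t = \<one>"
    using z tr_closed unfolding t_def by (auto simp: field_Units)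
  have \<alpha>_t: "\<alpha> t = t" if \<alpha>: "\<alpha> \<in> H" for \<alpha>
  proof -
    interpret \<alpha>: ring_hom_cring R R \<alpha> by (rule hom[OF \<alpha>])
    have "\<alpha> (tr z) = tr z" using tr_fixed[OF z(1)] \<alpha> by (auto simp: fixed_field_def)
    hence "tr z \<otimes> \<alpha> t = \<one>" using \<alpha>.hom_mult[of "tr z" t] t tr_closed[OF z(1)] by simp
    thus ?thesis using t \<alpha>.hom_closed[OF t(1)] tr_closed[OF z(1)] by (metis comm_inv_char)
  qed
  have "tr (z \<otimes> (t \<otimes> x)) = (\<Oplus>\<alpha>\<in>H. \<alpha> z \<otimes> (t \<otimes> x))"
    unfolding tr_def
  proof (rule finsum_cong'[OF refl])
    fix \<alpha> assume \<alpha>: "\<alpha> \<in> H"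
    interpret \<alpha>: ring_hom_cring R R \<alpha> by (rule hom[OF \<alpha>])
    show "\<alpha> (z \<otimes> (t \<otimes> x)) = \<alpha> z \<otimes> (t \<otimes> x)"
      using z t x \<alpha>_t[OF \<alpha>] x(2)[OF \<alpha>] by simp
  qed (use closed z t x in auto)
  also have "\<dots> = tr z \<otimes> (t \<otimes> x)"
    unfolding tr_def using closed z t x by (intro finsum_ldistr[symmetric] finite_group) auto
  also have "\<dots> = x" using t x tr_closed[OF z(1)] by (simp add: m_assoc[symmetric])
  finally show thesis using z t x by (intro that[of "z \<otimes> (t \<otimes> x)"]) auto
qed

text \<open>Artin's theorem. For \<open>\<beta>\<close> outside \<open>H\<close> the coset
  \<open>?T\<close> is disjoint from \<open>H\<close>. Since \<open>\<beta>\<close> fixes traces,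
  the sums over \<open>H\<close> and over \<open>?T\<close> agree at every element, which
  contradicts the independence of automorphisms.\<close>

lemma galois_group_fixed_field: "carrier (galois_group R (fixed_field R H)) = H"
proof (intro equalityI subsetI)
  fix \<alpha> assume "\<alpha> \<in> H"
  thus "\<alpha> \<in> carrier (galois_group R (fixed_field R H))"
    using Bij ring_homs by (auto simp: galois_group_carrier_iff fixed_field_def)
next
  fix \<beta> assume "\<beta> \<in> carrier (galois_group R (fixed_field R H))"
  hence \<beta>: "\<beta> \<in> ring_hom R R" "\<beta> \<in> Bij (carrier R)" "\<And>x. x \<in> fixed_field R H \<Longrightarrow> \<beta> x = x"
    by (auto simp: galois_group_carrier_iff)
  have \<beta>_B: "\<beta> \<in> carrier (BijGroup (carrier R))" using \<beta> by (simp add: carrier_BijGroup)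
  show "\<beta> \<in> H"
  proof (rule ccontr)
    assume notin: "\<beta> \<notin> H"
    let ?T = "(\<lambda>\<alpha>. \<beta> \<cdot> \<alpha>) ` H"
    have disj: "H \<inter> ?T = {}"
    proof -
      have "\<beta> \<cdot> \<alpha> \<notin> H" if \<alpha>: "\<alpha> \<in> H" for \<alpha>
      proof
        assume "\<beta> \<cdot> \<alpha> \<in> H"
        hence "(\<beta> \<cdot> \<alpha>) \<cdot> ainv \<alpha> \<in> H" using \<alpha> by (rule_tac mult_mem[OF _ inv_mem])
        also have "(\<beta> \<cdot> \<alpha>) \<cdot> ainv \<alpha> = \<beta>"
          using mem_carrier[OF \<alpha>] by (metis B.inv_closed B.m_assoc B.r_inv B.r_one \<beta>_B)
        finally show False using notin by simp
      qed
      thus ?thesis by auto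
    qed
    have Tsub: "?T \<subseteq> carrier (galois_group R {})"
      using subgroup.m_closed[OF subgroup_galois_group[of "{}"]] \<beta>(1,2) ring_homs Bij
      by (auto simp: galois_group_carrier_iff)
    define c where "c \<alpha> = (if \<alpha> \<in> H then \<one> else \<ominus> \<one>)" for \<alpha>
    have T: "\<alpha> e \<in> carrier R" if "\<alpha> \<in> ?T" "e \<in> carrier R" for \<alpha> e
    proof -
      have "\<alpha> \<in> ring_hom R R" using subsetD[OF Tsub that(1)] by (simp add: galois_group_carrier_iff)
      thus ?thesis using that(2) by (rule ring_hom_closed)
    qed
    have "(\<Oplus>\<alpha>\<in>H \<union> ?T. c \<alpha> \<otimes> \<alpha> e) = \<zero>" if e: "e \<in> carrier R" for e
    proof -
      have "(\<Oplus>\<alpha>\<in>H \<union> ?T. c \<alpha> \<otimes> \<alpha> e) = (\<Oplus>\<alpha>\<in>H. c \<alpha> \<otimes> \<alpha> e) \<oplus> (\<Oplus>\<alpha>\<in>?T. c \<alpha> \<otimes> \<alpha> e)"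
        using disj finite_group closed[OF _ e] T[OF _ e] by (intro finsum_Un_disjoint) (auto simp: c_def)
      also have "(\<Oplus>\<alpha>\<in>H. c \<alpha> \<otimes> \<alpha> e) = tr e"
        unfolding tr_def using closed e by (intro finsum_cong') (auto simp: c_def)
      also have "(\<Oplus>\<alpha>\<in>?T. c \<alpha> \<otimes> \<alpha> e) = (\<Oplus>\<alpha>\<in>?T. (\<ominus> \<one>) \<otimes> \<alpha> e)"
        using disj T e by (intro finsum_cong') (auto simp: c_def)
      also have "\<dots> = (\<ominus> \<one>) \<otimes> (\<Oplus>\<alpha>\<in>?T. \<alpha> e)"
        using T e finite_group by (intro finsum_rdistr[symmetric]) auto
      also have "(\<Oplus>\<alpha>\<in>?T. \<alpha> e) = (\<Oplus>\<alpha>\<in>H. (\<beta> \<cdot> \<alpha>) e)"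
        using T e left_translate(2)[OF \<beta>_B] by (intro finsum_reindex) auto
      also have "\<dots> = tr e"
        using apply_tr[OF \<beta>(2,1) e] \<beta>(3)[OF tr_fixed[OF e]] by simp
      also have "tr e \<oplus> (\<ominus> \<one>) \<otimes> tr e = \<zero>" using tr_closed[OF e] by (simp add: l_minus r_neg)
      finally show ?thesis .
    qed
    moreover have "H \<union> ?T \<subseteq> ring_hom R R" "H \<union> ?T \<subseteq> extensional (carrier R)"
      using ring_homs extensional Tsub
      by (auto simp: galois_group_carrier_iff subset_eq intro: Bij_imp_extensional)
    ultimately have "c \<alpha> = \<zero>" if "\<alpha> \<in> H" for \<alpha>
      using ring_homs_independent[of "H \<union> ?T" c \<alpha>] finite_group that by (auto simp: c_def)
    thus False using H_nonempty by (auto simp: c_def)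
  qed
qed

end

section \<open>The Galois correspondence\<close>

context finite_automorphism_group
begin

lemma subgroup_automorphism_group:
  assumes "subgroup S (BijGroup (carrier R))" "S \<subseteq> H"
  shows "finite_automorphism_group R S"
  using assms ring_homs rev_finite_subset[OF finite_group]
  by (intro finite_automorphism_group.intro finite_automorphism_group_axioms.intro field_axioms) auto

lemma fixed_field_subfield: "subfield (fixed_field R H) R"
proof (rule subfieldI')
  show "subring (fixed_field R H) R"
  proof (rule subringI)
    fix x assume "x \<in> fixed_field R H"
    hence x: "x \<in> carrier R" "\<And>\<alpha>. \<alpha> \<in> H \<Longrightarrow> \<alpha> x = x" by (auto simp: fixed_field_def)
    have "\<alpha> (\<ominus> x) = \<ominus> x" if "\<alpha> \<in> H" for \<alpha>
      using ring_hom_cring.hom_a_inv[OF hom[OF that] x(1)] x(2)[OF that] by simp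
    thus "\<ominus> x \<in> fixed_field R H" using x by (simp add: fixed_field_def)
    fix y assume "y \<in> fixed_field R H"
    hence y: "y \<in> carrier R" "\<And>\<alpha>. \<alpha> \<in> H \<Longrightarrow> \<alpha> y = y" by (auto simp: fixed_field_def)
    have "\<alpha> (x \<otimes> y) = x \<otimes> y" "\<alpha> (x \<oplus> y) = x \<oplus> y" if "\<alpha> \<in> H" for \<alpha>
      using ring_hom_mult[OF subsetD[OF ring_homs that] x(1) y(1)] x(2)[OF that] y(2)[OF that]
        ring_hom_add[OF subsetD[OF ring_homs that] x(1) y(1)] by simp_all
    thus "x \<otimes> y \<in> fixed_field R H" "x \<oplus> y \<in> fixed_field R H"
      using x y by (simp_all add: fixed_field_def)
  next
    show "\<one> \<in> fixed_field R H"
      using ring_hom_one[OF subsetD[OF ring_homs]] by (simp add: fixed_field_def)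
  qed (auto simp: fixed_field_def)
next
  fix x assume x: "x \<in> fixed_field R H - {\<zero>}"
  hence xc: "x \<in> carrier R" "x \<noteq> \<zero>" by (auto simp: fixed_field_def)
  hence inv: "inv x \<in> carrier R" "x \<otimes> inv x = \<one>" by (auto simp: field_Units)
  have "\<alpha> (inv x) = inv x" if \<alpha>: "\<alpha> \<in> H" for \<alpha>
  proof -
    interpret \<alpha>: ring_hom_cring R R \<alpha> by (rule hom[OF \<alpha>])
    have "\<alpha> x = x" using x \<alpha> by (auto simp: fixed_field_def)
    hence "x \<otimes> \<alpha> (inv x) = \<one>" using \<alpha>.hom_mult[of x "inv x"] inv xc by simp
    thus ?thesis using inv xc \<alpha>.hom_closed[OF inv(1)] by (metis comm_inv_char)
  qed
  thus "inv x \<in> fixed_field R H" using inv by (simp add: fixed_field_def)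
qed

text \<open>The functions \<open>f\<close> on \<open>H\<close> that absorb into \<open>N\<close> contain the constants if \<open>N\<close> contains the
  fixed field, and multiplying \<open>f\<close> by the evaluation at \<open>x\<close> multiplies \<open>N\<close> by \<open>x\<close>. Interpolating
  the indicator function of a subgroup \<open>S\<close> by products of differences of evaluations thus shows
  that all \<open>S\<close>-traces lie in \<open>N\<close>.\<close>

definition absorbs :: "'a set \<Rightarrow> (('a \<Rightarrow> 'a) \<Rightarrow> 'a) \<Rightarrow> bool" where
  "absorbs N f \<longleftrightarrow> f \<in> H \<rightarrow> carrier R \<and>
    (\<forall>z\<in>carrier R. (\<Oplus>\<alpha>\<in>H. \<alpha> (z \<otimes> f (ainv \<alpha>))) \<in> N)"

lemma absorbs_one:
  assumes "fixed_field R H \<subseteq> N"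
  shows "absorbs N (\<lambda>_. \<one>)"
proof -
  have "(\<Oplus>\<alpha>\<in>H. \<alpha> (z \<otimes> \<one>)) \<in> N" if "z \<in> carrier R" for z
    using tr_fixed[OF that] that assms by (simp add: tr_def subset_eq)
  thus ?thesis unfolding absorbs_def by auto
qed

text \<open>Only \<open>x\<close> interacts with \<open>N\<close>; the subtracted value
  \<open>o'\<close> and the scaling \<open>d\<close> disappear into the free factor
  \<open>z\<close>. \<open>N'\<close> is separate from \<open>N\<close> because in
  \<open>dimension_fixed_field\<close> each factor costs one more power of \<open>x\<close>.\<close>

lemma absorbs_mult:
  assumes f: "absorbs N f" and x: "x \<in> carrier R" "o' \<in> carrier R" "d \<in> carrier R"
    and add: "\<And>a b. a \<in> N \<Longrightarrow> b \<in> N \<Longrightarrow> a \<otimes> x \<oplus> b \<in> N'"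
  shows "absorbs N' (\<lambda>\<alpha>. f \<alpha> \<otimes> (\<alpha> x \<ominus> o') \<otimes> d)"
proof -
  have fc: "f \<alpha> \<in> carrier R" if "\<alpha> \<in> H" for \<alpha> using that f by (auto simp: absorbs_def)
  have cl: "f \<alpha> \<otimes> (\<alpha> x \<ominus> o') \<otimes> d \<in> carrier R" if "\<alpha> \<in> H" for \<alpha>
    using that fc closed x by simp
  have "(\<Oplus>\<alpha>\<in>H. \<alpha> (z \<otimes> (f (ainv \<alpha>) \<otimes> (ainv \<alpha> x \<ominus> o') \<otimes> d))) \<in> N'" if z: "z \<in> carrier R" for z
  proof -
    define u where "u = z \<otimes> d"
    define v where "v = z \<otimes> d \<otimes> (\<ominus> o')"
    have uv: "u \<in> carrier R" "v \<in> carrier R" using z x by (auto simp: u_def v_def)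
    \<comment> \<open>This is why \<open>absorbs\<close> evaluates \<open>f\<close> at the inverse:
      \<open>\<alpha>\<close> sends \<open>ainv \<alpha> x\<close> back to \<open>x\<close>, which
      then leaves the sum as a constant factor.\<close>
    have eq: "\<alpha> (z \<otimes> (f (ainv \<alpha>) \<otimes> (ainv \<alpha> x \<ominus> o') \<otimes> d)) =
        \<alpha> (u \<otimes> f (ainv \<alpha>)) \<otimes> x \<oplus> \<alpha> (v \<otimes> f (ainv \<alpha>))" if \<alpha>: "\<alpha> \<in> H" for \<alpha>
    proof -
      interpret \<alpha>: ring_hom_cring R R \<alpha> by (rule hom[OF \<alpha>])
      have c: "f (ainv \<alpha>) \<in> carrier R" "ainv \<alpha> x \<in> carrier R"
        using fc inv_mem[OF \<alpha>] closed x by auto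
      have "z \<otimes> (f (ainv \<alpha>) \<otimes> (ainv \<alpha> x \<ominus> o') \<otimes> d) =
          (u \<otimes> f (ainv \<alpha>)) \<otimes> ainv \<alpha> x \<oplus> v \<otimes> f (ainv \<alpha>)"
        using c z x unfolding u_def v_def minus_eq by algebra
      thus ?thesis using c uv inv_apply(2)[OF \<alpha> x(1)] by simp
    qed
    have A: "(\<lambda>\<alpha>. \<alpha> (u \<otimes> f (ainv \<alpha>))) \<in> H \<rightarrow> carrier R" "(\<lambda>\<alpha>. \<alpha> (v \<otimes> f (ainv \<alpha>))) \<in> H \<rightarrow> carrier R"
      using closed fc inv_mem uv by auto
    have "(\<Oplus>\<alpha>\<in>H. \<alpha> (z \<otimes> (f (ainv \<alpha>) \<otimes> (ainv \<alpha> x \<ominus> o') \<otimes> d))) =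
        (\<Oplus>\<alpha>\<in>H. \<alpha> (u \<otimes> f (ainv \<alpha>)) \<otimes> x \<oplus> \<alpha> (v \<otimes> f (ainv \<alpha>)))"
      using A x by (intro finsum_cong' eq refl) auto
    also have "\<dots> = (\<Oplus>\<alpha>\<in>H. \<alpha> (u \<otimes> f (ainv \<alpha>)) \<otimes> x) \<oplus> (\<Oplus>\<alpha>\<in>H. \<alpha> (v \<otimes> f (ainv \<alpha>)))"
      using A x by (intro finsum_addf) auto
    also have "(\<Oplus>\<alpha>\<in>H. \<alpha> (u \<otimes> f (ainv \<alpha>)) \<otimes> x) = (\<Oplus>\<alpha>\<in>H. \<alpha> (u \<otimes> f (ainv \<alpha>))) \<otimes> x"
      using A x finite_group by (intro finsum_ldistr[symmetric]) auto
    also have "(\<Oplus>\<alpha>\<in>H. \<alpha> (u \<otimes> f (ainv \<alpha>))) \<otimes> x \<oplus> (\<Oplus>\<alpha>\<in>H. \<alpha> (v \<otimes> f (ainv \<alpha>))) \<in> N'"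
      using f uv by (intro add) (auto simp: absorbs_def)
    finally show ?thesis .
  qed
  thus ?thesis unfolding absorbs_def using cl by auto
qed

text \<open>For the indicator function of \<open>S\<close> the sum over \<open>H\<close> collapses
  to the trace of \<open>S\<close>, since \<open>S\<close> is closed under inverses, and these
  traces exhaust the fixed field of \<open>S\<close>.\<close>

lemma absorbs_indicator:
  assumes S: "subgroup S (BijGroup (carrier R))" "S \<subseteq> H"
    and f: "absorbs N f" "\<And>\<alpha>. \<alpha> \<in> S \<Longrightarrow> f \<alpha> = \<one>" "\<And>\<alpha>. \<alpha> \<in> H - S \<Longrightarrow> f \<alpha> = \<zero>"
    and x: "x \<in> fixed_field R S"
  shows "x \<in> N"
proof -
  interpret S: finite_automorphism_group R S by (rule subgroup_automorphism_group[OF S])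
  obtain z where z: "z \<in> carrier R" "S.tr z = x" by (rule S.fixed_field_eq_range_tr[OF x])
  have inS: "ainv \<alpha> \<in> H - S" if "\<alpha> \<in> H - S" for \<alpha>
    using that inv_mem S.inv_mem B.inv_inv[OF mem_carrier] by (metis Diff_iff)
  have "S.tr z = (\<Oplus>\<alpha>\<in>H. \<alpha> (z \<otimes> f (ainv \<alpha>)))"
    unfolding S.tr_def
  proof (rule add.finprod_mono_neutral_cong_left[OF finite_group S(2)])
    fix \<alpha> assume \<alpha>: "\<alpha> \<in> H - S"
    thus "\<alpha> (z \<otimes> f (ainv \<alpha>)) = \<zero>"
      using f(3)[OF inS[OF \<alpha>]] z ring_hom_cring.hom_zero[OF hom] by simp
  next
    fix \<alpha> assume \<alpha>: "\<alpha> \<in> S"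
    thus "\<alpha> z = \<alpha> (z \<otimes> f (ainv \<alpha>))"
      using f(2)[OF S.inv_mem] z by simp
  next
    have "f (ainv \<alpha>) \<in> carrier R" if "\<alpha> \<in> H" for \<alpha>
      using f(1) inv_mem[OF that] by (auto simp: absorbs_def)
    thus "(\<lambda>\<alpha>. \<alpha> (z \<otimes> f (ainv \<alpha>))) \<in> H \<rightarrow> carrier R" using closed z by auto
  qed
  thus ?thesis using f(1) z by (auto simp: absorbs_def)
qed

lemma stabilizer_subgroup:
  assumes "E \<subseteq> carrier R"
  shows "subgroup {\<alpha> \<in> H. \<forall>x\<in>E. \<alpha> x = x} (BijGroup (carrier R))"
proof -
  have "{\<alpha> \<in> H. \<forall>x\<in>E. \<alpha> x = x} = H \<inter> carrier (galois_group R E)"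
    using ring_homs Bij by (auto simp: galois_group_carrier_iff)
  thus ?thesis
    using B.subgroups_Inter_pair[OF subgroup_BijGroup subgroup_galois_group[OF assms]] by simp
qed

lemma galois_group_intermediate:
  assumes "fixed_field R H \<subseteq> E"
  shows "carrier (galois_group R E) = {\<alpha> \<in> H. \<forall>x\<in>E. \<alpha> x = x}"
proof -
  have "carrier (galois_group R E) \<subseteq> carrier (galois_group R (fixed_field R H))"
    using assms by (simp add: subset_eq galois_group_carrier_iff)
  hence "carrier (galois_group R E) \<subseteq> H" by (simp only: galois_group_fixed_field)
  thus ?thesis using ring_homs Bij by (auto simp: galois_group_carrier_iff)
qed

text \<open>The indicator of the stabilizer is a product of factors, one for each
  \<open>\<beta>\<close> that moves some \<open>e\<close> of \<open>E\<close>. Each factor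
  multiplies by elements of \<open>E\<close> only, so \<open>E\<close> keeps absorbing.\<close>

lemma fixed_field_galois_group:
  assumes E: "subfield E R" and KE: "fixed_field R H \<subseteq> E"
  shows "fixed_field R (carrier (galois_group R E)) = E"
proof
  let ?S = "{\<alpha> \<in> H. \<forall>x\<in>E. \<alpha> x = x}"
  note Esub = subfieldE(3)[OF E] and Ering = subringE[OF subfieldE(1)[OF E]]
  have eq: "carrier (galois_group R E) = ?S" by (rule galois_group_intermediate[OF KE])
  have "\<exists>f. absorbs E f \<and> (\<forall>\<alpha>\<in>?S. f \<alpha> = \<one>) \<and> (\<forall>\<alpha>\<in>T. f \<alpha> = \<zero>)" if "finite T" "T \<subseteq> H - ?S" for T
    using that
  proof (induction T)
    case empty
    show ?case using absorbs_one[OF KE] by auto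
  next
    case (insert \<beta> T)
    then obtain f where f: "absorbs E f" "\<forall>\<alpha>\<in>?S. f \<alpha> = \<one>" "\<forall>\<alpha>\<in>T. f \<alpha> = \<zero>" by auto
    obtain e where e: "e \<in> E" "\<beta> e \<noteq> e" and \<beta>: "\<beta> \<in> H" using insert.prems by auto
    have ec: "e \<in> carrier R" "\<beta> e \<in> carrier R" using e Esub closed[OF \<beta>] by auto
    let ?d = "inv (e \<ominus> \<beta> e)"
    have nz: "e \<ominus> \<beta> e \<noteq> \<zero>" using ec e by (simp add: r_right_minus_eq)
    have d: "?d \<in> carrier R" "(e \<ominus> \<beta> e) \<otimes> ?d = \<one>"
      using nz ec by (auto simp: field_Units)
    \<comment> \<open>The Lagrange factor with value one wherever \<open>\<alpha> e = e\<close> and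
      zero at \<open>\<beta>\<close>; \<open>\<beta> e\<close> itself may lie outside
      \<open>E\<close>.\<close>
    let ?f = "\<lambda>\<alpha>. f \<alpha> \<otimes> (\<alpha> e \<ominus> \<beta> e) \<otimes> ?d"
    have "absorbs E ?f"
      using ec d e Ering by (intro absorbs_mult[OF f(1)]) auto
    moreover have "?f \<alpha> = \<one>" if "\<alpha> \<in> ?S" for \<alpha>
    proof -
      have "\<alpha> e = e" "f \<alpha> = \<one>" using that e f by auto
      thus ?thesis using d ec by simp
    qed
    moreover have "?f \<alpha> = \<zero>" if \<alpha>: "\<alpha> \<in> insert \<beta> T" for \<alpha>
    proof -
      have "\<alpha> \<in> H" using \<alpha> insert.prems by auto
      hence c: "f \<alpha> \<in> carrier R" "\<alpha> e \<in> carrier R" using f(1) closed ec by (auto simp: absorbs_def)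
      have "f \<alpha> = \<zero> \<or> \<alpha> e \<ominus> \<beta> e = \<zero>" using \<alpha> f(3) ec by (auto simp: r_right_minus_eq)
      thus ?thesis using c ec d by (elim disjE) (simp_all add: minus_eq r_neg)
    qed
    ultimately show ?case by (intro exI[of _ ?f]) blast
  qed
  from this[of "H - ?S"] obtain f where
    f: "absorbs E f" "\<forall>\<alpha>\<in>?S. f \<alpha> = \<one>" "\<forall>\<alpha>\<in>H - ?S. f \<alpha> = \<zero>"
    using finite_group by auto
  show "fixed_field R (carrier (galois_group R E)) \<subseteq> E"
    unfolding eq
    using absorbs_indicator[OF stabilizer_subgroup[OF Esub] _ f(1)] f by blast
  show "E \<subseteq> fixed_field R (carrier (galois_group R E))"
    unfolding eq using Esub by (auto simp: fixed_field_def)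
qed

section \<open>The degree of the fixed field of a stabilizer\<close>

lemma hom_eval:
  assumes "\<alpha> \<in> H" "set q \<subseteq> fixed_field R H" "x \<in> carrier R"
  shows "\<alpha> (eval q x) = eval q (\<alpha> x)"
  using assms(2)
proof (induction q)
  interpret \<alpha>: ring_hom_cring R R \<alpha> by (rule hom[OF assms(1)])
  case Nil
  show ?case by simp
next
  interpret \<alpha>: ring_hom_cring R R \<alpha> by (rule hom[OF assms(1)])
  case (Cons a q)
  have pow: "\<alpha> (x [^] n) = \<alpha> x [^] n" for n :: nat
    using assms(3) by (induction n) auto
  have "\<alpha> a = a" "a \<in> carrier R" "set q \<subseteq> carrier R"
    using Cons.prems assms(1) by (auto simp: fixed_field_def)
  thus ?case using Cons pow eval_in_carrier[of q x] assms(3) by simp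
qed

text \<open>Automorphisms permute the roots of a polynomial with fixed coefficients, so all
  conjugates of \<open>x\<close> are roots of its minimal polynomial.\<close>

lemma card_orbit_le_degree_Irr:
  assumes x: "x \<in> carrier R" "(algebraic over (fixed_field R H)) x"
  shows "card ((\<lambda>\<alpha>. \<alpha> x) ` H) \<le> degree (Irr (fixed_field R H) x)"
proof -
  let ?K = "fixed_field R H" and ?q = "Irr (fixed_field R H) x"
  note K = fixed_field_subfield
  note q = IrrE[OF K x]
  have qK: "set ?q \<subseteq> ?K"
    using q(1) polynomial_incl univ_poly_carrier by blast
  have qR: "?q \<in> carrier (poly_ring R)"
    using q(1) carrier_polynomial_shell[OF subfieldE(1)[OF K]] by auto
  have nz: "?q \<noteq> []" using q(2) pirreducibleE(1)[OF subfieldE(1)[OF K] q(1)] by auto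
  have "(\<lambda>\<alpha>. \<alpha> x) ` H \<subseteq> set_mset (roots ?q)"
  proof
    fix y assume "y \<in> (\<lambda>\<alpha>. \<alpha> x) ` H"
    then obtain \<alpha> where \<alpha>: "\<alpha> \<in> H" "y = \<alpha> x" by auto
    have "eval ?q y = \<zero>"
      using hom_eval[OF \<alpha>(1) qK x(1)] q(4) ring_hom_cring.hom_zero[OF hom[OF \<alpha>(1)]] \<alpha> by simp
    thus "y \<in> set_mset (roots ?q)"
      using roots_mem_iff_is_root[OF qR] nz \<alpha> closed x by (auto simp: is_root_def)
  qed
  hence "card ((\<lambda>\<alpha>. \<alpha> x) ` H) \<le> card (set_mset (roots ?q))"
    by (intro card_mono) auto
  also have "\<dots> \<le> size (roots ?q)"
    using size_mset_mono[OF mset_set_set_mset_msubset[of "roots ?q"]] by simp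
  also have "\<dots> \<le> degree ?q" by (rule size_roots_le_degree[OF qR])
  finally show ?thesis .
qed

lemma Span_exp_base_Suc:
  assumes K: "subfield K R" and x: "x \<in> carrier R"
    and ab: "a \<in> Span K (exp_base x n)" "b \<in> Span K (exp_base x n)"
  shows "a \<otimes> x \<oplus> b \<in> Span K (exp_base x (Suc n))"
proof -
  have eb: "set (exp_base x m) \<subseteq> carrier R" for m by (rule exp_base_closed[OF x])
  obtain Ks where Ks: "set Ks \<subseteq> K" "length Ks = n" "a = combine Ks (exp_base x n)"
    using ab(1) Span_eq_combine_set_length_version[OF K eb[of n]] by (auto simp: exp_base_def)
  have KsR: "set Ks \<subseteq> carrier R" using Ks(1) subfieldE(3)[OF K] by auto
  \<comment> \<open>Coefficient lists start with the highest power, so multiplication by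
    \<open>x\<close> appends a zero.\<close>
  have "a \<otimes> x = eval (Ks @ [\<zero>]) x"
    using Ks combine_eq_eval[of Ks x] eval_append_aux[OF KsR zero_closed x] eval_in_carrier[OF KsR x] x
    by simp
  also have "\<dots> = combine (Ks @ [\<zero>]) (exp_base x (Suc n))"
    using combine_eq_eval[of "Ks @ [\<zero>]" x] Ks(2) by simp
  also have "\<dots> \<in> Span K (exp_base x (Suc n))"
    using Ks subringE(2)[OF subfieldE(1)[OF K]]
    unfolding Span_eq_combine_set[OF K eb[of "Suc n"]]
    by (intro CollectI exI[of _ "Ks @ [\<zero>]"]) simp
  finally have "a \<otimes> x \<in> Span K (exp_base x (Suc n))" .
  moreover have "b \<in> Span K (exp_base x (Suc n))"
    using ab(2) mono_Span[OF K eb[of n], of "x [^] n"] x by (auto simp: exp_base_def)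
  ultimately show ?thesis
    using Span_subgroup_props(3)[OF K eb[of "Suc n"]] by blast
qed

text \<open>With d the size of the orbit, the powers of \<open>x\<close> below d form a basis. They
  span because interpolating over the d - 1 other conjugates uses no higher power; they are
  independent because the minimal polynomial has degree at least d.\<close>

lemma dimension_fixed_field:
  assumes x: "x \<in> carrier R"
    and S: "S = {\<alpha> \<in> H. \<alpha> x = x}"
  shows "dimension (card ((\<lambda>\<alpha>. \<alpha> x) ` H)) (fixed_field R H) (fixed_field R S)"
proof -
  let ?K = "fixed_field R H" and ?O = "(\<lambda>\<alpha>. \<alpha> x) ` H" and ?M = "fixed_field R S"
  note K = fixed_field_subfield
  have sS: "subgroup S (BijGroup (carrier R))" "S \<subseteq> H"
    using stabilizer_subgroup[of "{x}"] x S by auto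
  interpret S: finite_automorphism_group R S by (rule subgroup_automorphism_group[OF sS])
  note M = S.fixed_field_subfield
  have KM: "?K \<subseteq> ?M" using sS by (auto simp: fixed_field_def)
  have xM: "x \<in> ?M" using x S by (auto simp: fixed_field_def)
  \<comment> \<open>No factor needs only the constants, which are the span of the single power
    \<open>x [^] 0\<close>; hence the successor.\<close>
  have "\<exists>f. absorbs (Span ?K (exp_base x (Suc (card T)))) f \<and> (\<forall>\<alpha>\<in>S. f \<alpha> = \<one>) \<and>
      (\<forall>\<alpha>\<in>H. \<alpha> x \<in> T \<longrightarrow> f \<alpha> = \<zero>)" if "finite T" "T \<subseteq> carrier R - {x}" for T
    using that
  proof (induction T)
    case empty
    have "?K \<subseteq> Span ?K (exp_base x (Suc 0))"
    proof
      fix k assume k: "k \<in> ?K"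
      have "k \<in> carrier R" using k by (simp add: fixed_field_def)
      hence "k = combine [k] (exp_base x (Suc 0))" by (simp add: exp_base_def)
      thus "k \<in> Span ?K (exp_base x (Suc 0))"
        using k unfolding Span_eq_combine_set[OF K exp_base_closed[OF x]]
        by (auto intro!: exI[of _ "[k]"])
    qed
    thus ?case using absorbs_one by auto
  next
    case (insert y T)
    then obtain f where f: "absorbs (Span ?K (exp_base x (Suc (card T)))) f" "\<forall>\<alpha>\<in>S. f \<alpha> = \<one>"
      "\<forall>\<alpha>\<in>H. \<alpha> x \<in> T \<longrightarrow> f \<alpha> = \<zero>" by auto
    have y: "y \<in> carrier R" "y \<noteq> x" using insert.prems by auto
    let ?d = "inv (x \<ominus> y)"
    have nz: "x \<ominus> y \<noteq> \<zero>" using x y by (simp add: r_right_minus_eq)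
    have d: "?d \<in> carrier R" "(x \<ominus> y) \<otimes> ?d = \<one>"
      using nz x y by (auto simp: field_Units)
    let ?f = "\<lambda>\<alpha>. f \<alpha> \<otimes> (\<alpha> x \<ominus> y) \<otimes> ?d"
    have "absorbs (Span ?K (exp_base x (Suc (Suc (card T))))) ?f"
      by (rule absorbs_mult[OF f(1) x y(1) d(1)]) (rule Span_exp_base_Suc[OF K x])
    moreover have "?f \<alpha> = \<one>" if "\<alpha> \<in> S" for \<alpha>
    proof -
      have "\<alpha> x = x" "f \<alpha> = \<one>" using that S f by auto
      thus ?thesis using d x y by simp
    qed
    moreover have "?f \<alpha> = \<zero>" if \<alpha>: "\<alpha> \<in> H" "\<alpha> x \<in> insert y T" for \<alpha>
    proof -
      have c: "f \<alpha> \<in> carrier R" "\<alpha> x \<in> carrier R" using f(1) closed x \<alpha> by (auto simp: absorbs_def)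
      have "f \<alpha> = \<zero> \<or> \<alpha> x \<ominus> y = \<zero>" using \<alpha> f(3) y by (auto simp: r_right_minus_eq)
      thus ?thesis using c x y d by (elim disjE) (simp_all add: minus_eq r_neg)
    qed
    ultimately show ?case using insert.hyps by (intro exI[of _ ?f]) auto
  qed
  from this[of "?O - {x}"] obtain f where
    f: "absorbs (Span ?K (exp_base x (Suc (card (?O - {x}))))) f" "\<forall>\<alpha>\<in>S. f \<alpha> = \<one>"
      "\<forall>\<alpha>\<in>H. \<alpha> x \<in> ?O - {x} \<longrightarrow> f \<alpha> = \<zero>"
    using finite_group closed x by auto
  obtain \<alpha> where "\<alpha> \<in> S" using S.H_nonempty by auto
  hence "x = \<alpha> x" "\<alpha> \<in> H" using S by auto
  hence "x \<in> ?O" by (rule image_eqI)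
  hence card: "Suc (card (?O - {x})) = card ?O" using finite_group by (intro card.remove[symmetric]) auto
  have sub: "?M \<subseteq> Span ?K (exp_base x (card ?O))"
    using absorbs_indicator[OF sS f(1)] f(2,3) unfolding card S by blast
  have "subalgebra ?K ?M R"
    using M KM subringE[OF subfieldE(1)[OF M]] unfolding subalgebra_def subalgebra_axioms_def
    by (auto intro: subring.axioms(1) subfieldE(1))
  moreover have "set (exp_base x n) \<subseteq> ?M" for n
  proof -
    have "x [^] i \<in> ?M" for i :: nat
      using subringE(3,6)[OF subfieldE(1)[OF M]] xM by (induction i) auto
    thus ?thesis by (auto simp: exp_base_def)
  qed
  ultimately have Span: "Span ?K (exp_base x (card ?O)) = ?M"
    using subalgebra_Span_incl[OF K] sub by blast
  \<comment> \<open>Algebraicity of \<open>x\<close> over the fixed field is obtained from the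
    spanning half, and opens the way to its minimal polynomial.\<close>
  have "finite_dimension ?K ?M"
    using Span_finite_dimension[OF K exp_base_closed[OF x]] Span by metis
  hence alg: "(algebraic over ?K) x"
    by (rule finite_dimension_imp_algebraic[OF K subfieldE(1)[OF M] _ xM])
  \<comment> \<open>Powers are listed in descending order, so the shorter list is a tail of the
    longer independent one.\<close>
  obtain Vs where "exp_base x (degree (Irr ?K x)) = Vs @ exp_base x (card ?O)"
    using exp_base_append[of x "card ?O" "degree (Irr ?K x) - card ?O"]
      le_add_diff_inverse[OF card_orbit_le_degree_Irr[OF x alg]] by metis
  hence "independent ?K (exp_base x (card ?O))"
    using exp_base_independent[OF K x alg] independent_split(1)[OF K] by simp
  from dimensionI[OF K this Span] show ?thesis by (simp add: exp_base_def)
qed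

end

section \<open>The Frattini quotient\<close>

lemma exists_maximal_subgroup:
  assumes G: "group G" "finite (carrier G)" and H: "subgroup H G" "H \<noteq> carrier G"
  obtains M where "maximal_subgroup M G" "H \<subseteq> M"
proof -
  interpret group G by (rule G)
  let ?A = "{U. subgroup U G \<and> H \<subseteq> U \<and> U \<noteq> carrier G}"
  have "finite ?A"
    by (rule finite_subset[of _ "Pow (carrier G)"]) (auto simp: G dest: subgroup.subset)
  moreover have "H \<in> ?A" using H by simp
  ultimately obtain M where M: "M \<in> ?A" "\<forall>U\<in>?A. M \<subseteq> U \<longrightarrow> M = U"
    using finite_has_maximal[of ?A] by (metis (no_types, lifting) empty_iff)
  hence "maximal_subgroup M G" unfolding maximal_subgroup_def by blast
  thus thesis using M that by blast
qed

lemma (in group) frattini_subgroup: "subgroup (frattini G) G"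
proof -
  have "subgroup (\<Inter> (insert (carrier G) {M. maximal_subgroup M G})) G"
    by (rule subgroups_Inter) (auto simp: maximal_subgroup_def subgroup_self)
  thus ?thesis by (simp add: frattini_def)
qed

lemma
  fixes G (structure)
  assumes p: "Factorial_Ring.prime p" and G: "finite_p_group p G"
  shows p_group_frattini_normal: "frattini G \<lhd> G"
    and p_group_pow_in_frattini: "x \<in> carrier G \<Longrightarrow> x [^] p \<in> frattini G"
    and p_group_commutator_in_frattini: "\<lbrakk>x \<in> carrier G; y \<in> carrier G\<rbrakk> \<Longrightarrow>
      x \<otimes> y \<otimes> inv x \<otimes> inv y \<in> frattini G"
proof -
  interpret group G using G by (simp add: finite_p_group_def)
  show "frattini G \<lhd> G"
  proof (unfold normal_inv_iff, intro conjI ballI frattini_subgroup)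
    fix x h assume xh: "x \<in> carrier G" "h \<in> frattini G"
    have "x \<otimes> h \<otimes> inv x \<in> M" if "maximal_subgroup M G" for M
      using normal.inv_op_closed2[OF p_group_maximal_subgroup_normal[OF p G that]] xh that
      by (auto simp: frattini_def)
    thus "x \<otimes> h \<otimes> inv x \<in> frattini G" using xh by (auto simp: frattini_def)
  qed
  show "x [^] p \<in> frattini G" if "x \<in> carrier G"
    using p_group_maximal_subgroup_pow[OF p G] that by (auto simp: frattini_def)
  show "x \<otimes> y \<otimes> inv x \<otimes> inv y \<in> frattini G" if "x \<in> carrier G" "y \<in> carrier G"
    using p_group_maximal_subgroup_derived[OF p G] that by (fastforce simp: frattini_def)
qed

lemma group_rank_le:
  assumes "S \<subseteq> carrier G" "finite S" "generate G S = carrier G"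
  shows "group_rank G \<le> card S"
  unfolding group_rank_def using assms by (intro Least_le) blast

lemma group_rank_obtain:
  assumes "group G" "finite (carrier G)"
  obtains S where "S \<subseteq> carrier G" "finite S" "card S = group_rank G" "generate G S = carrier G"
proof -
  have "generate G (carrier G) = carrier G"
    using group.generateI[OF assms(1) group.subgroup_self[OF assms(1)], of "carrier G"]
      subgroup.subset by blast
  hence "\<exists>n. \<exists>S\<subseteq>carrier G. finite S \<and> card S = n \<and> generate G S = carrier G"
    using assms(2) by blast
  from LeastI_ex[OF this] show thesis using that by (auto simp: group_rank_def)
qed

text \<open>Lifts of generators generate: otherwise they lie in a maximal subgroup, which also
  contains the kernel and hence every element of the group. The quotient is given by a homomorphism
  so that restriction to K_\<phi> can be plugged in.\<close>

lemma group_rank_frattini_quotient: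
  fixes G (structure) and V
  assumes G: "finite (carrier G)" and hom: "group_hom G V r" and surj: "r ` carrier G = carrier V"
    and ker: "kernel G V r = frattini G"
  shows "group_rank V = group_rank G"
proof (rule antisym)
  interpret group_hom G V r by (rule hom)
  obtain S where S: "S \<subseteq> carrier G" "finite S" "card S = group_rank G" "generate G S = carrier G"
    by (rule group_rank_obtain[OF G.group_axioms G])
  have "generate V (r ` S) = carrier V"
    using generate_img[OF S(1)] S(4) surj by simp
  moreover have "r ` S \<subseteq> carrier V" using S(1) surj by auto
  ultimately have "group_rank V \<le> card (r ` S)"
    using S(2) by (intro group_rank_le) auto
  also have "\<dots> \<le> group_rank G" using card_image_le[OF S(2), of r] S(3) by simp
  finally show "group_rank V \<le> group_rank G" .
  have finV: "finite (carrier V)" using G surj by (metis finite_imageI)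
  obtain T where T: "T \<subseteq> carrier V" "finite T" "card T = group_rank V" "generate V T = carrier V"
    by (rule group_rank_obtain[OF H.is_group finV])
  \<comment> \<open>One preimage per generator, so that the lift has the same size as
    \<open>T\<close>.\<close>
  obtain U where U: "U \<subseteq> carrier G" "inj_on r U" "T = r ` U"
    using T(1) surj subset_image_inj[of T r "carrier G"] by auto
  have cardU: "card U = card T" "finite U" using U G finite_subset by (auto simp: card_image)
  have "generate G U = carrier G"
  proof (rule ccontr)
    assume neq: "generate G U \<noteq> carrier G"
    obtain M where M: "maximal_subgroup M G" "generate G U \<subseteq> M"
      by (rule exists_maximal_subgroup[OF G.group_axioms G G.generate_is_subgroup[OF U(1)] neq])
    have sM: "subgroup M G" "M \<noteq> carrier G" using M(1) by (auto simp: maximal_subgroup_def)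
    have "g \<in> M" if g: "g \<in> carrier G" for g
    proof -
      have "r g \<in> generate V (r ` U)" using g T(4) U(3) surj by auto
      then obtain u where u: "u \<in> generate G U" "r g = r u" using generate_img[OF U(1)] by auto
      have uG: "u \<in> carrier G" using u(1) G.generate_in_carrier[OF U(1)] by simp
      have "r (inv u \<otimes> g) = \<one>\<^bsub>V\<^esub>" using u uG g by simp
      hence "inv u \<otimes> g \<in> frattini G" using uG g unfolding ker[symmetric] by (simp add: kernel_def)
      hence "inv u \<otimes> g \<in> M" using M(1) by (auto simp: frattini_def)
      hence "u \<otimes> (inv u \<otimes> g) \<in> M" using M(2) u(1) by (rule_tac subgroup.m_closed[OF sM(1)]) auto
      thus "g \<in> M" using uG g by (simp add: G.m_assoc[symmetric])
    qed
    thus False using sM subgroup.subset by blast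
  qed
  hence "group_rank G \<le> card U" using U(1) cardU by (intro group_rank_le) auto
  thus "group_rank G \<le> group_rank V" using cardU T by simp
qed

lemma elementary_abelian_frattini_quotient:
  fixes G (structure) and V
  assumes p: "Factorial_Ring.prime p" and G: "finite_p_group p G"
    and hom: "group_hom G V r" and surj: "r ` carrier G = carrier V"
    and ker: "kernel G V r = frattini G"
  shows "elementary_abelian_group V p"
proof -
  interpret group_hom G V r by (rule hom)
  have fin: "finite (carrier G)" using G by (simp add: finite_p_group_def)
  have one: "r x = \<one>\<^bsub>V\<^esub>" if "x \<in> frattini G" for x
    using that unfolding ker[symmetric] by (simp add: kernel_def)
  have "comm_group V"
  proof (rule group.group_comm_groupI[OF H.is_group])
    fix a b assume "a \<in> carrier V" "b \<in> carrier V"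
    then obtain x y where xy: "x \<in> carrier G" "y \<in> carrier G" "a = r x" "b = r y"
      unfolding surj[symmetric] by blast
    have "r (x \<otimes> y \<otimes> inv x \<otimes> inv y \<otimes> (y \<otimes> x)) = r (y \<otimes> x)"
      using one[OF p_group_commutator_in_frattini[OF p G xy(1,2)]] xy by simp
    moreover have "x \<otimes> y \<otimes> inv x \<otimes> inv y \<otimes> (y \<otimes> x) = x \<otimes> y"
    proof -
      have "inv y \<otimes> (y \<otimes> x) = x" using xy by (simp add: G.m_assoc[symmetric])
      thus ?thesis using xy by (simp add: G.m_assoc)
    qed
    ultimately show "a \<otimes>\<^bsub>V\<^esub> b = b \<otimes>\<^bsub>V\<^esub> a" using xy by simp
  qed
  moreover have "v [^]\<^bsub>V\<^esub> p = \<one>\<^bsub>V\<^esub>" if "v \<in> carrier V" for v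
  proof -
    obtain x where x: "x \<in> carrier G" "v = r x" using \<open>v \<in> carrier V\<close> unfolding surj[symmetric] by blast
    thus ?thesis using one[OF p_group_pow_in_frattini[OF p G x(1)]] by (simp add: hom_nat_pow)
  qed
  moreover have "finite_p_group p V"
  proof -
    have "order V = card (rcosets (kernel G V r))"
      using iso_same_card[OF FactGroup_iso[OF surj]] by (simp add: order_def FactGroup_def)
    hence "order V dvd order G"
      using G.lagrange[OF subgroup_kernel] by (metis dvd_triv_left)
    thus ?thesis
      using G divides_primepow_nat[OF p] surj fin unfolding finite_p_group_def
      by (metis H.is_group finite_imageI)
  qed
  ultimately show ?thesis
    using p by (simp add: elementary_abelian_group_def elementary_abelian_group_axioms_def)
qed

text \<open>Any \<open>x\<close> fixed by \<open>J\<close> but not by \<open>H\<close> has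
  stabilizer exactly \<open>J\<close>, as nothing lies strictly between \<open>J\<close> and
  \<open>H\<close>. Its orbit then has \<open>p\<close> elements and the degree formula for
  stabilizers applies.\<close>

lemma (in finite_automorphism_group) dimension_index_prime:
  assumes p: "Factorial_Ring.prime p" and pG: "finite_p_group p (BijGroup (carrier R)\<lparr>carrier := H\<rparr>)"
    and J: "subgroup J (BijGroup (carrier R)\<lparr>carrier := H\<rparr>)" and card: "card H = p * card J"
  shows "dimension p (fixed_field R H) (fixed_field R J)"
proof -
  let ?G = "BijGroup (carrier R)\<lparr>carrier := H\<rparr>"
  have JB: "subgroup J (BijGroup (carrier R))" "J \<subseteq> H"
    using B.incl_subgroup[OF subgroup_BijGroup J] subgroup.subset[OF J] by auto
  interpret J: finite_automorphism_group R J by (rule subgroup_automorphism_group[OF JB])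
  have cardJ: "card J > 0" using J.finite_group J.H_nonempty by (simp add: card_gt_0_iff)
  have "J \<noteq> H" using card cardJ prime_gt_1_nat[OF p] by auto
  hence "fixed_field R J \<noteq> fixed_field R H"
    using galois_group_fixed_field J.galois_group_fixed_field by metis
  moreover have "fixed_field R H \<subseteq> fixed_field R J" using JB(2) by (auto simp: fixed_field_def)
  ultimately obtain x where x: "x \<in> fixed_field R J" "x \<notin> fixed_field R H" by auto
  have xR: "x \<in> carrier R" using x by (simp add: fixed_field_def)
  define S where "S = {\<alpha> \<in> H. \<alpha> x = x}"
  have SB: "subgroup S (BijGroup (carrier R))" using stabilizer_subgroup[of "{x}"] xR by (simp add: S_def)
  have S: "subgroup S ?G" by (rule B.subgroup_incl[OF SB subgroup_BijGroup]) (auto simp: S_def)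
  have JS: "J \<subseteq> S" using x JB by (auto simp: S_def fixed_field_def)
  have "S \<noteq> H" using x xR by (auto simp: S_def fixed_field_def)
  have "S = J"
  proof (rule ccontr)
    assume "S \<noteq> J"
    hence "p * card J \<le> card S" using card_subgroup_less_p_group(1)[OF p pG J S] JS by auto
    hence "S = H" using card by (intro card_seteq finite_group) (auto simp: S_def)
    thus False using \<open>S \<noteq> H\<close> by simp
  qed
  interpret A: group_action ?G "carrier R" "\<lambda>\<alpha>. \<alpha>"
    using group.subgroup_imp_group[OF group_BijGroup subgroup_BijGroup] group_BijGroup Bij
    by (auto simp: group_action_def group_hom_def group_hom_axioms_def hom_def carrier_BijGroup)
  have "card ((\<lambda>\<alpha>. \<alpha> x) ` H) * card S = card H"
    using A.orbit_stabilizer_theorem[OF xR]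
    by (simp add: orbit_def stabilizer_def S_def order_def image_def Setcompr_eq_image)
  hence "card ((\<lambda>\<alpha>. \<alpha> x) ` H) = p" using \<open>S = J\<close> card cardJ by simp
  thus ?thesis using dimension_fixed_field[OF xR S_def] \<open>S = J\<close> by simp
qed

section \<open>Intermediate fields of the Frattini field\<close>

text \<open>Minimal intermediate fields are defined by dimension in L, while the correspondence is
  applied inside K_\<phi>; the inclusion carries dimensions over.\<close>

lemma (in ring) dimension_from_subring:
  assumes "subring F R" "subfield K (R\<lparr>carrier := F\<rparr>)" "\<one> \<noteq> \<zero>"
    and "ring.dimension (R\<lparr>carrier := F\<rparr>) n K E" "E \<subseteq> F"
  shows "dimension n K E"
proof -
  have "F \<subseteq> carrier R" by (rule subringE(1)[OF assms(1)])
  interpret ring_hom_ring "R\<lparr>carrier := F\<rparr>" R "\<lambda>x. x"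
    using subring_is_ring[OF assms(1)] ring_axioms \<open>F \<subseteq> carrier R\<close>
    by (intro ring_hom_ringI) auto
  show ?thesis
    using inj_hom_dimension[OF assms(2,3) _ assms(4)] by simp
qed

lemma (in field) subfield_of_subfield_iff:
  assumes "subfield F R"
  shows "subfield E (R\<lparr>carrier := F\<rparr>) \<longleftrightarrow> subfield E R \<and> E \<subseteq> F"
proof -
  interpret F: field "R\<lparr>carrier := F\<rparr>" by (rule subfield_iff(2)[OF assms])
  have FR: "F \<subseteq> carrier R" by (rule subfieldE(3)[OF assms])
  show ?thesis
  proof
    assume E: "subfield E (R\<lparr>carrier := F\<rparr>)"
    have "E \<subseteq> F" using subfieldE(3)[OF E] by simp
    moreover have "field (R\<lparr>carrier := E\<rparr>)" using F.subfield_iff(2)[OF E] by simp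
    ultimately show "subfield E R \<and> E \<subseteq> F" using subfield_iff(1)[of E] FR by auto
  next
    assume E: "subfield E R \<and> E \<subseteq> F"
    thus "subfield E (R\<lparr>carrier := F\<rparr>)"
      using F.subfield_iff(1)[of E] subfield_iff(2)[of E] by simp
  qed
qed

locale p_galois_extension =
  fixes L :: "('a, 'b) ring_scheme" and K :: "'a set" and p :: nat
  assumes prime: "Factorial_Ring.prime p"
    and galois: "galois_extension L K"
    and p_group: "finite_p_group p (galois_group L K)"
begin

abbreviation "G \<equiv> galois_group L K"
abbreviation "F \<equiv> frattini_field L K"
abbreviation "L' \<equiv> L\<lparr>carrier := F\<rparr>"
text \<open>Automorphisms of \<open>L'\<close> rather than a factor group, so that the
  correspondence applies directly; \<open>restriction\<close> identifies it with the quotient of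
  \<open>G\<close>.\<close>

abbreviation "V \<equiv> galois_group L' K"
abbreviation restriction :: "('a \<Rightarrow> 'a) \<Rightarrow> 'a \<Rightarrow> 'a" where "restriction \<alpha> \<equiv> restrict \<alpha> F"

sublocale L: field L using galois by (simp add: galois_extension_def)

lemma K: "subfield K L" "K \<subseteq> carrier L"
  using galois subfieldE(3) by (auto simp: galois_extension_def)

lemma fixed_field_G: "fixed_field L (carrier G) = K"
  using galois by (simp add: galois_extension_def)

sublocale GL: finite_automorphism_group L "carrier G"
  using L.subgroup_galois_group[OF K(2)] p_group
  by (intro finite_automorphism_group.intro finite_automorphism_group_axioms.intro L.field_axioms)
    (auto simp: finite_p_group_def galois_group_carrier_iff)

sublocale G: group G using p_group by (simp add: finite_p_group_def)

lemma G_mult: "\<alpha> \<otimes>\<^bsub>G\<^esub> \<beta> = \<alpha> \<otimes>\<^bsub>BijGroup (carrier L)\<^esub> \<beta>"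
  by (simp add: galois_group_def)

lemma frattini_normal: "frattini G \<lhd> G"
  by (rule p_group_frattini_normal[OF prime p_group])

sublocale Phi: finite_automorphism_group L "frattini G"
proof (rule GL.subgroup_automorphism_group)
  have "subgroup (frattini G) (BijGroup (carrier L)\<lparr>carrier := carrier G\<rparr>)"
    using G.frattini_subgroup galois_group_eq_subgroup[of L K] by simp
  thus "subgroup (frattini G) (BijGroup (carrier L))"
    by (rule group.incl_subgroup[OF group_BijGroup GL.subgroup_BijGroup])
  show "frattini G \<subseteq> carrier G" by (auto simp: frattini_def)
qed

lemma F: "subfield F L" "F \<subseteq> carrier L" "K \<subseteq> F"
proof -
  show "subfield F L" unfolding frattini_field_def by (rule Phi.fixed_field_subfield)
  thus "F \<subseteq> carrier L" by (rule subfieldE(3))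
  show "K \<subseteq> F" using fixed_field_G by (auto simp: frattini_field_def fixed_field_def frattini_def)
qed

sublocale L': field L' by (rule L.subfield_iff(2)[OF F(1)])

lemma galois_group_F: "carrier (galois_group L F) = frattini G"
  unfolding frattini_field_def by (rule Phi.galois_group_fixed_field)

section \<open>Restriction to the Frattini field\<close>

text \<open>Normality of the Frattini subgroup: moving \<open>\<beta>\<close> past
  \<open>\<alpha>\<close> replaces it by a conjugate, which still fixes \<open>x\<close>.\<close>

lemma F_closed:
  assumes \<alpha>: "\<alpha> \<in> carrier G" and x: "x \<in> F"
  shows "\<alpha> x \<in> F"
proof -
  have xL: "x \<in> carrier L" using F(2) x by (rule subsetD)
  have "\<beta> (\<alpha> x) = \<alpha> x" if \<beta>: "\<beta> \<in> frattini G" for \<beta>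
  proof -
    let ?\<gamma> = "inv\<^bsub>G\<^esub> \<alpha> \<otimes>\<^bsub>G\<^esub> \<beta> \<otimes>\<^bsub>G\<^esub> \<alpha>"
    have \<beta>G: "\<beta> \<in> carrier G" using \<beta> by (simp add: frattini_def)
    have \<gamma>: "?\<gamma> \<in> frattini G" by (rule normal.inv_op_closed1[OF frattini_normal \<alpha> \<beta>])
    hence \<gamma>G: "?\<gamma> \<in> carrier G" by (simp add: frattini_def)
    have "\<beta> \<otimes>\<^bsub>G\<^esub> \<alpha> = \<alpha> \<otimes>\<^bsub>G\<^esub> ?\<gamma>"
      using \<alpha> \<beta>G by (simp add: G.m_assoc[symmetric])
    hence "(\<beta> \<otimes>\<^bsub>G\<^esub> \<alpha>) x = (\<alpha> \<otimes>\<^bsub>G\<^esub> ?\<gamma>) x" by simp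
    hence "\<beta> (\<alpha> x) = \<alpha> (?\<gamma> x)"
      using GL.mult_apply[OF \<beta>G \<alpha> xL] GL.mult_apply[OF \<alpha> \<gamma>G xL] by (simp only: G_mult)
    moreover have "?\<gamma> x = x" using x \<gamma> by (simp add: frattini_field_def fixed_field_def)
    ultimately show ?thesis by simp
  qed
  thus ?thesis using GL.closed[OF \<alpha> xL] by (simp add: frattini_field_def fixed_field_def)
qed

lemma restriction_mem:
  assumes \<alpha>: "\<alpha> \<in> carrier G"
  shows "restriction \<alpha> \<in> carrier V"
proof -
  have inv: "inv\<^bsub>G\<^esub> \<alpha> \<in> carrier G" using \<alpha> by simp
  have eq: "inv\<^bsub>G\<^esub> \<alpha> = inv\<^bsub>BijGroup (carrier L)\<^esub> \<alpha>"
    using group.m_inv_consistent[OF group_BijGroup GL.subgroup_BijGroup \<alpha>]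
    by (simp flip: galois_group_eq_subgroup)
  have "bij_betw \<alpha> F F"
  proof (rule bij_betw_byWitness[of _ "inv\<^bsub>G\<^esub> \<alpha>"])
    show "\<forall>x\<in>F. (inv\<^bsub>G\<^esub> \<alpha>) (\<alpha> x) = x" "\<forall>x\<in>F. \<alpha> ((inv\<^bsub>G\<^esub> \<alpha>) x) = x"
      using GL.inv_apply[OF \<alpha>] F(2) unfolding eq by blast+
  qed (use F_closed[OF \<alpha>] F_closed[OF inv] in auto)
  hence "restriction \<alpha> \<in> Bij F"
    unfolding Bij_def by (simp add: bij_betw_cong[of F "restriction \<alpha>" \<alpha>])
  moreover have hom: "\<alpha> \<in> ring_hom L L" using \<alpha> GL.ring_homs by auto
  have "restriction \<alpha> \<in> ring_hom L' L'"
  proof (rule ring_hom_memI)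
    fix x y assume xy: "x \<in> carrier L'" "y \<in> carrier L'"
    hence xyL: "x \<in> carrier L" "y \<in> carrier L" using F(2) by auto
    show "restriction \<alpha> (x \<otimes>\<^bsub>L'\<^esub> y) = restriction \<alpha> x \<otimes>\<^bsub>L'\<^esub> restriction \<alpha> y"
      using L'.m_closed[OF xy] xy ring_hom_mult[OF hom xyL] by simp
    show "restriction \<alpha> (x \<oplus>\<^bsub>L'\<^esub> y) = restriction \<alpha> x \<oplus>\<^bsub>L'\<^esub> restriction \<alpha> y"
      using L'.a_closed[OF xy] xy ring_hom_add[OF hom xyL] by simp
  next
    show "restriction \<alpha> \<one>\<^bsub>L'\<^esub> = \<one>\<^bsub>L'\<^esub>"
      using L'.one_closed ring_hom_one[OF hom] by simp
  qed (use F_closed[OF \<alpha>] in auto)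
  moreover have "\<forall>x\<in>K. restriction \<alpha> x = x"
    using \<alpha> F(3) by (auto simp: galois_group_carrier_iff)
  ultimately show ?thesis by (simp add: galois_group_carrier_iff)
qed

lemma group_V: "group V"
  using L'.group_galois_group[of K] F(3) by simp

lemma V_mult: "\<alpha> \<otimes>\<^bsub>V\<^esub> \<beta> = \<alpha> \<otimes>\<^bsub>BijGroup F\<^esub> \<beta>"
  by (simp add: galois_group_def)

lemma V_Bij: "\<alpha> \<in> carrier V \<Longrightarrow> \<alpha> \<in> Bij F"
  by (simp add: galois_group_carrier_iff)

lemma restriction_hom: "group_hom G V restriction"
proof -
  have "restriction (\<alpha> \<otimes>\<^bsub>G\<^esub> \<beta>) = restriction \<alpha> \<otimes>\<^bsub>V\<^esub> restriction \<beta>"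
    if ab: "\<alpha> \<in> carrier G" "\<beta> \<in> carrier G" for \<alpha> \<beta>
  proof
    fix x
    have rab: "restriction \<alpha> \<in> Bij F" "restriction \<beta> \<in> Bij F"
      using restriction_mem ab V_Bij by auto
    show "restriction (\<alpha> \<otimes>\<^bsub>G\<^esub> \<beta>) x = (restriction \<alpha> \<otimes>\<^bsub>V\<^esub> restriction \<beta>) x"
    proof (cases "x \<in> F")
      case True
      hence "x \<in> carrier L" using F(2) by auto
      thus ?thesis
        using True GL.mult_apply[OF ab] BijGroup_mult_apply[OF rab True] F_closed[OF ab(2) True]
        by (simp add: G_mult V_mult)
    next
      case False
      have "restriction \<alpha> \<otimes>\<^bsub>BijGroup F\<^esub> restriction \<beta> \<in> Bij F"
        using rab monoid.m_closed[OF group.is_monoid[OF group_BijGroup]] by (metis carrier_BijGroup)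
      from extensional_arb[OF Bij_imp_extensional[OF this] False] show ?thesis
        using False by (simp add: V_mult)
    qed
  qed
  thus ?thesis
    using restriction_mem G.is_group group_V by (simp add: group_hom_def group_hom_axioms_def hom_def)
qed

text \<open>By Artin's theorem, applied to the Frattini subgroup, no further automorphism is trivial
  on \<open>F\<close>.\<close>

lemma restriction_kernel: "kernel G V restriction = frattini G"
proof -
  have one: "\<one>\<^bsub>V\<^esub> = (\<lambda>x\<in>F. x)" by (simp add: galois_group_def BijGroup_def)
  have "\<alpha> \<in> kernel G V restriction \<longleftrightarrow> \<alpha> \<in> frattini G" if "\<alpha> \<in> carrier G" for \<alpha>
  proof -
    have "restriction \<alpha> = \<one>\<^bsub>V\<^esub> \<longleftrightarrow> (\<forall>x\<in>F. \<alpha> x = x)"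
      unfolding one by (metis restrict_apply' restrict_ext)
    also have "\<dots> \<longleftrightarrow> \<alpha> \<in> carrier (galois_group L F)"
      using that by (simp add: galois_group_carrier_iff)
    finally show ?thesis using that by (simp add: kernel_def galois_group_F)
  qed
  thus ?thesis by (auto simp: kernel_def frattini_def)
qed

lemma fixed_field_restrictions: "fixed_field L' (restriction ` carrier G) = K"
proof (intro equalityI subsetI)
  fix x assume x: "x \<in> fixed_field L' (restriction ` carrier G)"
  hence xF: "x \<in> F" by (simp add: fixed_field_def)
  have "\<alpha> x = x" if "\<alpha> \<in> carrier G" for \<alpha>
  proof -
    have "restriction \<alpha> x = x" using x that unfolding fixed_field_def by blast
    thus ?thesis using xF by simp
  qed
  hence "x \<in> fixed_field L (carrier G)" using xF F(2) by (auto simp: fixed_field_def)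
  thus "x \<in> K" by (simp add: fixed_field_G)
next
  fix x assume "x \<in> K"
  thus "x \<in> fixed_field L' (restriction ` carrier G)"
    using F(3) by (auto simp: fixed_field_def galois_group_carrier_iff)
qed

text \<open>The restrictions form a finite group with fixed field \<open>K\<close>, so Artin's
  theorem makes them the full group \<open>V\<close>.\<close>

lemma restriction_surj: "restriction ` carrier G = carrier V"
proof -
  let ?A = "restriction ` carrier G"
  interpret r: group_hom G V restriction by (rule restriction_hom)
  have "subgroup ?A V" by (rule r.img_is_subgroup)
  hence "subgroup ?A (BijGroup F\<lparr>carrier := carrier V\<rparr>)"
    using galois_group_eq_subgroup[of L' K] by simp
  hence sub: "subgroup ?A (BijGroup F)"
    using group.incl_subgroup[OF group_BijGroup, of "carrier V" F] L'.subgroup_galois_group[of K] F(3)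
    by simp
  interpret A: finite_automorphism_group L' ?A
    using sub GL.finite_group restriction_mem
    by (intro finite_automorphism_group.intro finite_automorphism_group_axioms.intro L'.field_axioms)
      (auto simp: galois_group_carrier_iff)
  show ?thesis using A.galois_group_fixed_field by (simp add: fixed_field_restrictions)
qed

sublocale V: elementary_abelian_group V p
  by (rule elementary_abelian_frattini_quotient[OF prime p_group restriction_hom restriction_surj restriction_kernel])

lemma order_V: "order V = p ^ group_rank G"
proof -
  obtain m where m: "order V = p ^ m" using V.p_group by (auto simp: finite_p_group_def)
  hence "group_rank V = m" by (rule V.group_rank_eq)
  moreover have "group_rank V = group_rank G"
    using p_group group_rank_frattini_quotient[OF _ restriction_hom restriction_surj restriction_kernel]
    by (simp add: finite_p_group_def)
  ultimately show ?thesis using m by simp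
qed

sublocale VL: finite_automorphism_group L' "carrier V"
  using L'.subgroup_galois_group[of K] F(3) V.finite_carrier
  by (intro finite_automorphism_group.intro finite_automorphism_group_axioms.intro L'.field_axioms)
    (auto simp: galois_group_carrier_iff)

lemma fixed_field_V: "fixed_field L' (carrier V) = K"
  using fixed_field_restrictions by (simp only: restriction_surj)

section \<open>Intermediate fields of the Frattini field and subgroups of \<open>V\<close>\<close>

definition intermediate :: "'a set \<Rightarrow> bool" where
  "intermediate E \<longleftrightarrow> intermediate_field L K E \<and> E \<subseteq> F"

abbreviation "Gal E \<equiv> carrier (galois_group L' E)"
abbreviation "Fix W \<equiv> fixed_field L' W"

lemma intermediate_iff: "intermediate E \<longleftrightarrow> subfield E L' \<and> K \<subseteq> E"
  using L.subfield_of_subfield_iff[OF F(1)] by (auto simp: intermediate_def intermediate_field_def)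

text \<open>Links the two ambient groups: the correspondence speaks of subgroups of
  \<open>BijGroup F\<close>, the linear algebra of subgroups of \<open>V\<close>.\<close>

lemma subgroup_V_iff: "subgroup W V \<longleftrightarrow> subgroup W (BijGroup F) \<and> W \<subseteq> carrier V"
  using group.incl_subgroup[OF group_BijGroup, of "carrier V" F W]
    group.subgroup_incl[OF group_BijGroup, of W F "carrier V"] VL.subgroup_BijGroup
    galois_group_eq_subgroup[of L' K] subgroup.subset[of W V]
  by auto

lemma Gal_eq: "intermediate E \<Longrightarrow> Gal E = {\<alpha> \<in> carrier V. \<forall>x\<in>E. \<alpha> x = x}"
  using VL.galois_group_intermediate[of E] by (simp add: fixed_field_V intermediate_iff)

lemma subgroup_Gal: "intermediate E \<Longrightarrow> subgroup (Gal E) V"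
  using VL.stabilizer_subgroup[of E] subfieldE(3)[of E L'] Gal_eq[of E]
  by (auto simp: subgroup_V_iff intermediate_iff)

lemma Fix_Gal: "intermediate E \<Longrightarrow> Fix (Gal E) = E"
  using VL.fixed_field_galois_group[of E] by (simp add: fixed_field_V intermediate_iff)

lemma subgroup_automorphism_group: "subgroup W V \<Longrightarrow> finite_automorphism_group L' W"
  using VL.subgroup_automorphism_group[of W] by (simp add: subgroup_V_iff)

lemma Gal_Fix: "subgroup W V \<Longrightarrow> Gal (Fix W) = W"
  by (rule finite_automorphism_group.galois_group_fixed_field[OF subgroup_automorphism_group])

lemma intermediate_Fix: "subgroup W V \<Longrightarrow> intermediate (Fix W)"
  using finite_automorphism_group.fixed_field_subfield[OF subgroup_automorphism_group]
    fixed_field_V subgroup.subset[of W V]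
  by (auto simp: intermediate_iff fixed_field_def)

lemma Fix_mono: "W \<subseteq> W' \<Longrightarrow> Fix W' \<subseteq> Fix W"
  by (auto simp: fixed_field_def)

lemma bij_betw_Gal: "bij_betw Gal {E. intermediate E} {W. subgroup W V}"
  by (rule bij_betw_byWitness[of _ Fix]) (auto simp: Fix_Gal Gal_Fix subgroup_Gal intermediate_Fix)

section \<open>Minimal intermediate fields and composita\<close>

lemma dimension_Fix_hyperplane:
  assumes "V.hyperplane W"
  shows "ring.dimension L p K (Fix W)"
proof (rule L.dimension_from_subring[OF subfieldE(1)[OF F(1)]])
  show "subfield K L'" using intermediate_Fix[OF V.subgroup_self] by (simp add: fixed_field_V intermediate_iff)
  show "ring.dimension L' p K (Fix W)"
  proof -
    have eq: "BijGroup (carrier L')\<lparr>carrier := carrier V\<rparr> = V" by (simp add: galois_group_def)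
    show ?thesis
      using VL.dimension_index_prime[OF prime, of W, unfolded eq fixed_field_V] V.p_group assms
      by (simp add: order_def)
  qed
qed (auto simp: fixed_field_def)

text \<open>From degree \<open>p\<close> to a hyperplane: \<open>Gal M\<close> is proper, hence
  inside some hyperplane \<open>U\<close>. Then \<open>Fix U\<close> lies in \<open>M\<close>, both
  have dimension \<open>p\<close> over \<open>K\<close>, and they coincide.\<close>

lemma minimal_iff_hyperplane:
  assumes M: "intermediate M"
  shows "minimal_intermediate_field p L K M \<longleftrightarrow> V.hyperplane (Gal M)"
proof
  assume "V.hyperplane (Gal M)"
  thus "minimal_intermediate_field p L K M"
    using dimension_Fix_hyperplane[of "Gal M"] M Fix_Gal[OF M]
    by (simp add: minimal_intermediate_field_def intermediate_def)
next
  assume "minimal_intermediate_field p L K M"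
  hence dim: "ring.dimension L p K M" by (simp add: minimal_intermediate_field_def)
  have "M \<noteq> K"
    using L.dimension_is_inj[OF K(1) dim] L.dimension_one[OF K(1)] V.p_gt_1 by auto
  hence "Gal M \<noteq> carrier V" using Fix_Gal[OF M] fixed_field_V by auto
  then obtain x where x: "x \<in> carrier V" "x \<notin> Gal M"
    using subgroup.subset[OF subgroup_Gal[OF M]] by auto
  obtain U where U: "V.hyperplane U" "Gal M \<subseteq> U" "x \<notin> U"
    by (rule V.exists_hyperplane_avoiding[OF subgroup_Gal[OF M] x])
  have sub: "Fix U \<subseteq> M" using Fix_mono[OF U(2)] Fix_Gal[OF M] by simp
  \<comment> \<open>A basis of \<open>Fix U\<close> consists of \<open>p\<close> independent
    elements of \<open>M\<close>, so it spans \<open>M\<close> as well.\<close>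
  obtain Vs where Vs: "L.independent K Vs" "length Vs = p" "L.Span K Vs = Fix U"
    using L.exists_base[OF K(1) dimension_Fix_hyperplane[OF U(1)]] by auto
  have "set Vs \<subseteq> L.Span K Vs"
    by (rule L.Span_base_incl[OF K(1) L.independent_in_carrier[OF Vs(1)]])
  hence "L.Span K Vs = M"
    using L.independent_length_eq_dimension[OF K(1) dim Vs(1)] Vs sub by auto
  hence "Gal M = U" using Gal_Fix[of U] U(1) Vs(3) by simp
  thus "V.hyperplane (Gal M)" using U by simp
qed

text \<open>Automorphisms fixing every member fix a subfield containing all of them, hence the
  compositum. For the empty family both sides are the group of \<open>K\<close>.\<close>

lemma compositum_intermediate:
  assumes "\<forall>M\<in>S. intermediate M" "finite S"
  shows "intermediate (compositum L K S)" "Gal (compositum L K S) = carrier V \<inter> \<Inter>(Gal ` S)"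
proof -
  let ?E = "compositum L K S" and ?W = "carrier V \<inter> \<Inter>(Gal ` S)"
  have sub: "K \<union> \<Union>S \<subseteq> F" using assms(1) F(3) by (auto simp: intermediate_def)
  hence subL: "K \<union> \<Union>S \<subseteq> carrier L" using F(2) by auto
  show E: "intermediate ?E"
    unfolding intermediate_def intermediate_field_def compositum_def
    using L.generate_field_is_subfield[OF subL] L.generate_field_min_subfield1[OF subL F(1) sub]
    by (auto intro: generate_field.incl)
  have "subgroup (\<Inter>(insert (carrier V) (Gal ` S))) V"
    by (rule V.subgroups_Inter) (use assms(1) subgroup_Gal V.subgroup_self in auto)
  hence W: "subgroup ?W V" by simp
  have "M \<subseteq> Fix ?W" if "M \<in> S" for M
    using that assms(1) Fix_Gal[of M] Fix_mono[of ?W "Gal M"] by auto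
  moreover have "K \<subseteq> Fix ?W" using intermediate_Fix[OF W] by (simp add: intermediate_iff)
  ultimately have "K \<union> \<Union>S \<subseteq> Fix ?W" by auto
  moreover have "subfield (Fix ?W) L"
    using intermediate_Fix[OF W] by (simp add: intermediate_def intermediate_field_def)
  ultimately have "?E \<subseteq> Fix ?W"
    unfolding compositum_def by (intro L.generate_field_min_subfield1[OF subL])
  hence "?W \<subseteq> Gal ?E" unfolding Gal_eq[OF E] by (auto simp: fixed_field_def)
  moreover have "Gal ?E \<subseteq> Gal M" if "M \<in> S" for M
  proof -
    have "M \<subseteq> ?E" using that by (auto simp: compositum_def intro: generate_field.incl)
    thus ?thesis by (simp add: subset_eq galois_group_carrier_iff)
  qed
  moreover have "Gal ?E \<subseteq> carrier V" using subgroup.subset[OF subgroup_Gal[OF E]] .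
  ultimately show "Gal ?E = ?W" by blast
qed

text \<open>\<open>Gal\<close> and \<open>Fix\<close> are injective on the families involved, so the
  number of members is preserved in both directions.\<close>

lemma compositum_of_minimal_iff:
  assumes E: "intermediate E"
  shows "compositum_of_minimal p L K m E \<longleftrightarrow>
    (\<exists>\<S>. finite \<S> \<and> card \<S> = m \<and> (\<forall>M\<in>\<S>. V.hyperplane M) \<and> carrier V \<inter> \<Inter>\<S> = Gal E)"
proof
  assume "compositum_of_minimal p L K m E"
  then obtain S where S: "S \<subseteq> {M. minimal_intermediate_field p L K M}" "finite S" "card S = m"
    "compositum L K S = E" by (auto simp: compositum_of_minimal_def)
  \<comment> \<open>The minimal fields range over all of L/K; being inside \<open>E\<close> puts
    them below \<open>F\<close>, where the correspondence holds.\<close>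
  have SE: "M \<subseteq> E" if "M \<in> S" for M
    using that unfolding S(4)[symmetric] by (auto simp: compositum_def intro: generate_field.incl)
  have intermediate: "intermediate M" if "M \<in> S" for M
    using SE[OF that] E S(1) that by (auto simp: intermediate_def minimal_intermediate_field_def)
  have "inj_on Gal S" by (rule inj_on_inverseI[of _ Fix]) (simp add: Fix_Gal intermediate)
  hence "card (Gal ` S) = m" using S(3) by (simp add: card_image)
  moreover have "V.hyperplane (Gal M)" if "M \<in> S" for M
    using minimal_iff_hyperplane[OF intermediate[OF that]] S(1) that by auto
  moreover have "carrier V \<inter> \<Inter>(Gal ` S) = Gal E"
    using compositum_intermediate(2)[of S] intermediate S by simp
  ultimately show "\<exists>\<S>. finite \<S> \<and> card \<S> = m \<and> (\<forall>M\<in>\<S>. V.hyperplane M) \<and> carrier V \<inter> \<Inter>\<S> = Gal E"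
    using S(2) by (intro exI[of _ "Gal ` S"]) auto
next
  assume "\<exists>\<S>. finite \<S> \<and> card \<S> = m \<and> (\<forall>M\<in>\<S>. V.hyperplane M) \<and> carrier V \<inter> \<Inter>\<S> = Gal E"
  then obtain \<S> where S: "finite \<S>" "card \<S> = m" "\<forall>M\<in>\<S>. V.hyperplane M" "carrier V \<inter> \<Inter>\<S> = Gal E"
    by auto
  have "inj_on Fix \<S>" by (rule inj_on_inverseI[of _ Gal]) (simp add: Gal_Fix S)
  hence card: "card (Fix ` \<S>) = m" using S(2) by (simp add: card_image)
  have intermediate: "\<forall>M\<in>Fix ` \<S>. intermediate M" using S(3) intermediate_Fix by auto
  have "Gal ` Fix ` \<S> = \<S>" using S(3) Gal_Fix by (force simp: image_image)
  hence "Gal (compositum L K (Fix ` \<S>)) = Gal E"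
    using compositum_intermediate(2)[OF intermediate] S by simp
  hence comp: "compositum L K (Fix ` \<S>) = E"
    using Fix_Gal[OF E] Fix_Gal[OF compositum_intermediate(1)[OF intermediate]] S(1) by simp
  have "minimal_intermediate_field p L K (Fix W)" if "W \<in> \<S>" for W
    using minimal_iff_hyperplane[of "Fix W"] intermediate_Fix[of W] Gal_Fix[of W] S(3) that by auto
  thus "compositum_of_minimal p L K m E"
    unfolding compositum_of_minimal_def using S(1) card comp
    by (intro exI[of _ "Fix ` \<S>"]) auto
qed

section \<open>The three counts\<close>

text \<open>Serves both graded counts, since compositum number and rank each amount to fixing the
  order of \<open>Gal E\<close>.\<close>

lemma card_intermediate:
  assumes "\<And>E. intermediate E \<Longrightarrow> P E \<longleftrightarrow> card (Gal E) = p ^ k"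
  shows "rat_of_nat (card {E. intermediate E \<and> P E}) = gauss_binomial p (group_rank G) k"
proof -
  have "bij_betw Gal {E. intermediate E \<and> P E} {W. subgroup W V \<and> card W = p ^ k}"
    by (rule bij_betw_byWitness[of _ Fix])
      (auto simp: assms Fix_Gal Gal_Fix subgroup_Gal intermediate_Fix)
  hence "card {E. intermediate E \<and> P E} = card {W. subgroup W V \<and> card W = p ^ k}"
    by (rule bij_betw_same_card)
  thus ?thesis using V.card_subgroups_of_order[OF order_V] by simp
qed

text \<open>Subgroup orders are powers of \<open>p\<close> with exponent at most the rank; sorting
  by exponent splits the total into the summands of the Gaussian sum.\<close>

lemma card_all_intermediate: "rat_of_nat (card {E. intermediate E}) = gauss_sum (group_rank G) p"
proof -
  let ?n = "group_rank G"
  let ?A = "\<lambda>k. {W. subgroup W V \<and> card W = p ^ k}"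
  have fin: "finite (?A k)" for k
    using V.finite_subgroups by (rule rev_finite_subset) auto
  have "card {E. intermediate E} = card {W. subgroup W V}"
    by (rule bij_betw_same_card[OF bij_betw_Gal])
  also have "{W. subgroup W V} = (\<Union>k\<in>{0..?n}. ?A k)"
  proof -
    have "\<exists>k\<in>{0..?n}. card W = p ^ k" if W: "subgroup W V" for W
    proof -
      obtain a where a: "card W = p ^ a" by (rule card_subgroup_p_group[OF prime V.p_group W])
      have "card W \<le> order V"
        unfolding order_def by (intro card_mono V.finite_carrier subgroup.subset[OF W])
      hence "a \<le> ?n" using a order_V V.p_gt_1 by simp
      thus ?thesis using a by auto
    qed
    thus ?thesis by blast
  qed
  also have "card \<dots> = (\<Sum>k\<in>{0..?n}. card (?A k))"
    using fin V.p_gt_1 by (intro card_UN_disjoint) auto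
  also have "rat_of_nat \<dots> = gauss_sum ?n p"
    unfolding gauss_sum_def of_nat_sum
    by (rule sum.cong[OF refl]) (rule V.card_subgroups_of_order[OF order_V])
  finally show ?thesis .
qed

text \<open>A subgroup of \<open>V\<close> is again elementary abelian, so its rank is the exponent
  of its order.\<close>

lemma group_rank_Gal_iff:
  assumes E: "intermediate E"
  shows "group_rank (galois_group L' E) = k \<longleftrightarrow> card (Gal E) = p ^ k"
proof -
  have eq: "galois_group L' E = V\<lparr>carrier := Gal E\<rparr>" by (simp add: galois_group_def)
  interpret E: elementary_abelian_group "galois_group L' E" p
    by (subst eq) (rule V.subgroup_elementary_abelian[OF subgroup_Gal[OF E]])
  obtain a where a: "card (Gal E) = p ^ a"
    by (rule card_subgroup_p_group[OF prime V.p_group subgroup_Gal[OF E]])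
  hence "group_rank (galois_group L' E) = a" by (intro E.group_rank_eq) (simp add: order_def)
  thus ?thesis using a V.p_gt_1 by simp
qed

lemma has_compositum_number_iff:
  assumes "intermediate E" "k \<le> group_rank G"
  shows "has_compositum_number p L K E (group_rank G - k) \<longleftrightarrow> card (Gal E) = p ^ k"
  unfolding has_compositum_number_def compositum_of_minimal_iff[OF assms(1)]
  by (rule V.Inter_hyperplanes_iff[OF subgroup_Gal[OF assms(1)] order_V assms(2)])

end

theorem theorem4p1:
  fixes L :: "('a, 'b) ring_scheme" and K :: "'a set" and p n :: nat
  assumes "Factorial_Ring.prime p"
    and "galois_extension L K"
    and "finite_p_group p (galois_group L K)"
    and "group_rank (galois_group L K) = n"
  shows "rat_of_nat (card {E. intermediate_field L K E \<and> E \<subseteq> frattini_field L K}) =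
           gauss_sum n p
       \<and> (\<forall>k\<le>n. rat_of_nat (card {E. intermediate_field L K E \<and> E \<subseteq> frattini_field L K \<and>
             has_compositum_number p L K E (n - k)}) = gauss_binomial p n k)
       \<and> (\<forall>k\<le>n. rat_of_nat (card {E. intermediate_field L K E \<and> E \<subseteq> frattini_field L K \<and>
             group_rank (galois_group (L\<lparr>carrier := frattini_field L K\<rparr>) E) = k}) =
             gauss_binomial p n k)"
proof -
  interpret p_galois_extension L K p using assms(1-3) by unfold_locales
  have n: "n = group_rank (galois_group L K)" using assms(4) by simp
  show ?thesis
    unfolding n
  proof (intro conjI allI impI)
    show "rat_of_nat (card {E. intermediate_field L K E \<and> E \<subseteq> frattini_field L K}) =
      gauss_sum (group_rank (galois_group L K)) p"
      using card_all_intermediate by (simp add: intermediate_def)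
  next
    fix k assume "k \<le> group_rank (galois_group L K)"
    thus "rat_of_nat (card {E. intermediate_field L K E \<and> E \<subseteq> frattini_field L K \<and>
        has_compositum_number p L K E (group_rank (galois_group L K) - k)}) =
      gauss_binomial p (group_rank (galois_group L K)) k"
      using card_intermediate[OF has_compositum_number_iff] by (simp add: intermediate_def conj_assoc)
  next
    fix k
    show "rat_of_nat (card {E. intermediate_field L K E \<and> E \<subseteq> frattini_field L K \<and>
        group_rank (galois_group (L\<lparr>carrier := frattini_field L K\<rparr>) E) = k}) =
      gauss_binomial p (group_rank (galois_group L K)) k"
      using card_intermediate[OF group_rank_Gal_iff] by (simp add: intermediate_def conj_assoc)
  qed
qed

end
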